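(* Let $\Gamma$ be a set of HoCHCs. The following are equivalent: (i) $\Gamma$ is $\mathcal A$-standard-satisfiable; (ii) $\Gamma$ is $\mathcal A$-Henkin-satisfiable; (iii) $\Gamma$ is $\mathcal A$-monotone-satisfiable; (iv) $\Gamma$ is $\mathcal A$-continuous-satisfiable; (v) $\Gamma$ is $(\mathcal A,\mathcal H)$-satisfiable, where $\mathcal H$ is a complete frame expanding $\mathcal A$.
   Context: Types. Fix a base type $\iota$. Argument types $\tau::=\iota\mid\rho$; relational types $\rho::=o\mid\tau\to\rho$; first-order types $\sigma_{FO}::=\iota\mid\iota\to o\mid\iota\to\sigma_{FO}$; types $\sigma::=\rho\mid\sigma_{FO}$. A fixed type environment $\Delta$ maps variables to argument types, $\Delta^{-1}(\tau)$ infinite for each $\tau$. Signatures are sets of typed symbols distinct from variables and the logical symbols $\neg,\land,\lor,\exists_\tau$. Terms: $M::=x\mid c\mid\neg\mid\land\mid\lor\mid\exists_\tau\mid MM\mid\lambda x.M$, simply typed ($\lambda x.M:\Delta(x)\to\rho$ only for $M$ of relational type $\rho$; $\land,\lor:o\to o\to o$; $\neg M:o$ for $M:o$; $\exists_\tau:(\tau\to o)\to o$). Formulas have type $o$. Positive existential: no $\neg$. Semantics: a pre-frame $\mathcal H$ gives nonempty sets $\mathcal H[\![\sigma]\!]$ with $\mathcal H[\![o]\!]=\{0,1\}$, function types interpreted by sets of functions, containing $\min,\max$ on $\{0,1\}$ and $E_\tau(r)=\max_{s\in\mathcal H[\![\tau]\!]}r(s)$. Denotation of terms in a $(\Sigma,\mathcal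 H)$-structure $\mathcal B$ under valuation $\alpha$ is standard ($\lambda x.M$ denotes $r\mapsto[\![M]\!]^{\mathcal B}(\alpha[x\mapsto r])$ if that function is in the frame, otherwise an arbitrary element). A frame is a pre-frame in which every positive existential $\lambda x.M$ denotes $r\mapsto[\![M]\!]^{\mathcal B}(\alpha[x\mapsto r])$. $\mathcal B\models F$ iff $F$ has value $1$ under all valuations. Order $\sqsubseteq$: equality on $\iota$, $\le$ on $o$, pointwise on functions; a frame is complete if each $\mathcal H[\![\rho]\!]$ ($\rho$ relational) is closed under pointwise least upper bounds of arbitrary subsets. Given a nonempty set $D$ for $\iota$: the standard frame $\mathcal S$ interprets $\tau\to\sigma$ as all functions, the monotone frame $\mathcal M$ as all monotone functions (w.r.t. $\sqsubseteq$), the continuous frame $\mathcal C$ as all Scott-continuous functions. Background: fixed first-order signature $\Sigma$, first-order $\Sigma$-structure $\mathcal A$, and $\Sigma'\supseteq\Sigma$ adding only relational-typed symbols. $\mathcal H$ expands $\mathcal A$ if $\mathcal H[\![\iota]\!]=\mathcal A[\![\iota]\!]$ and $c^{\mathcal A}\in\mathcal H[\![\sigma]\!]$ for all $c:\sigma\in\Sigma$; a $(\Sigma',\mathcal H)$-expansion of $\mathcal A$ agrees with $\mathcal A$ on $\Sigma$. Clauses: an atom is a $\Sigma'$-formula without logical symbols. Goal clause: $\neg A_1\lor\cdots\lor\neg A_n$; definite clause: $G\lor R\,x_1\cdots x_n$ with $G$ a goal clause, $R\in\Sigma'\setminus\Sigma$, $x_i$ distinct variables; HoCHC: goal or definite clause,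 free variables universally quantified. $\Gamma$ is $(\mathcal A,\mathcal H)$-satisfiable if some $(\Sigma',\mathcal H)$-expansion of $\mathcal A$ satisfies all clauses in $\Gamma$. $\mathcal A$-standard/-monotone/-continuous-satisfiable means $(\mathcal A,\mathcal S)$/$(\mathcal A,\mathcal M)$/$(\mathcal A,\mathcal C)$-satisfiable (with $D=\mathcal A[\![\iota]\!]$); $\mathcal A$-Henkin-satisfiable means $(\mathcal A,\mathcal H)$-satisfiable for some frame $\mathcal H$ expanding $\mathcal A$. *)

theory Defs
  imports Main
begin

text \<open>
  The full type hierarchy over an infinite set does not fit into any type definable in HOL, so the
  sets and functions of the semantics live in an ambient universe \<open>'u\<close> satisfying Zermelo's axioms
  (without infinity, foundation and choice). Separation is second-order, i.e. it holds for
  arbitrary HOL sets; hence power sets and function spaces in the universe are the full ones.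
\<close>

class zermelo =
  fixes elts :: "'a \<Rightarrow> 'a set"
  assumes extensionality: "elts a = elts b \<Longrightarrow> a = b"
    and separation: "X \<subseteq> elts a \<Longrightarrow> \<exists>b. elts b = X"
    and pairing: "\<exists>c. elts c = {a, b}"
    and union: "\<exists>b. elts b = \<Union> (elts ` elts a)"
    and powerset: "\<exists>b. elts b = {x. elts x \<subseteq> elts a}"

definition vset :: "'u::zermelo set \<Rightarrow> 'u" where
  "vset X = (THE a. elts a = X)"

definition vpair :: "'u::zermelo \<Rightarrow> 'u \<Rightarrow> 'u" where
  "vpair a b = vset {vset {a}, vset {a, b}}"

definition vlam :: "'u::zermelo \<Rightarrow> ('u \<Rightarrow> 'u) \<Rightarrow> 'u" where
  "vlam A f = vset {vpair x (f x) | x. x \<in> elts A}"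

definition vdom :: "'u::zermelo \<Rightarrow> 'u set" where
  "vdom f = {x. \<exists>y. vpair x y \<in> elts f}"

definition vapp :: "'u::zermelo \<Rightarrow> 'u \<Rightarrow> 'u" (infixl "\<bullet>" 90) where
  "f \<bullet> x = (THE y. vpair x y \<in> elts f)"

definition vfun :: "'u::zermelo \<Rightarrow> 'u \<Rightarrow> 'u" where
  "vfun A B = vset {vlam A f | f. \<forall>x \<in> elts A. f x \<in> elts B}"

definition fls :: "'u::zermelo" where "fls = vset {}"
definition tru :: "'u::zermelo" where "tru = vset {fls}"
definition bools :: "'u::zermelo" where "bools = vset {fls, tru}"

definition tv :: "bool \<Rightarrow> 'u::zermelo" where
  "tv P = (if P then tru else fls)"


section \<open>Types and terms\<close>

datatype ty = Iota | Omicron | Arrow ty ty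

fun relational :: "ty \<Rightarrow> bool" where
  "relational Iota = False"
| "relational Omicron = True"
| "relational (Arrow \<tau> \<rho>) = ((\<tau> = Iota \<or> relational \<tau>) \<and> relational \<rho>)"

definition argument_type :: "ty \<Rightarrow> bool" where
  "argument_type \<tau> \<longleftrightarrow> \<tau> = Iota \<or> relational \<tau>"

fun first_order :: "ty \<Rightarrow> bool" where
  "first_order Iota = True"
| "first_order Omicron = False"
| "first_order (Arrow \<tau> \<sigma>) = (\<tau> = Iota \<and> (\<sigma> = Omicron \<or> first_order \<sigma>))"

definition is_type :: "ty \<Rightarrow> bool" where
  "is_type \<sigma> \<longleftrightarrow> relational \<sigma> \<or> first_order \<sigma>"

definition type_env :: "('x \<Rightarrow> ty) \<Rightarrow> bool" where
  "type_env \<Delta> \<longleftrightarrow> (\<forall>x. argument_type (\<Delta> x)) \<and>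
     (\<forall>\<tau>. argument_type \<tau> \<longrightarrow> infinite {x. \<Delta> x = \<tau>})"

text \<open>A signature is a partial map: \<open>Sig c = Some \<sigma>\<close> means \<open>c : \<sigma> \<in> Sig\<close>.\<close>

definition signature :: "('c \<Rightarrow> ty option) \<Rightarrow> bool" where
  "signature Sig \<longleftrightarrow> (\<forall>c \<sigma>. Sig c = Some \<sigma> \<longrightarrow> is_type \<sigma>)"

definition fo_signature :: "('c \<Rightarrow> ty option) \<Rightarrow> bool" where
  "fo_signature Sig \<longleftrightarrow> (\<forall>c \<sigma>. Sig c = Some \<sigma> \<longrightarrow> first_order \<sigma>)"

definition relational_extension :: "('c \<Rightarrow> ty option) \<Rightarrow> ('c \<Rightarrow> ty option) \<Rightarrow> bool" where
  "relational_extension Sig Sig' \<longleftrightarrow> Sig \<subseteq>\<^sub>m Sig' \<and>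
     (\<forall>c \<rho>. c \<notin> dom Sig \<longrightarrow> Sig' c = Some \<rho> \<longrightarrow> relational \<rho>)"

text \<open>Negation is a unary constructor because it is typable only when applied to a formula.\<close>

datatype ('x, 'c) tm =
    Var 'x
  | Con 'c
  | Neg "('x, 'c) tm"
  | Conj
  | Disj
  | Ex ty
  | App "('x, 'c) tm" "('x, 'c) tm"
  | Lam 'x "('x, 'c) tm"

inductive has_type :: "('x \<Rightarrow> ty) \<Rightarrow> ('c \<Rightarrow> ty option) \<Rightarrow> ('x, 'c) tm \<Rightarrow> ty \<Rightarrow> bool"
  for \<Delta> :: "'x \<Rightarrow> ty" and Sig :: "'c \<Rightarrow> ty option"
where
  Var: "has_type \<Delta> Sig (Var x) (\<Delta> x)"
| Con: "Sig c = Some \<sigma> \<Longrightarrow> has_type \<Delta> Sig (Con c) \<sigma>"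
| Neg: "has_type \<Delta> Sig M Omicron \<Longrightarrow> has_type \<Delta> Sig (Neg M) Omicron"
| Conj: "has_type \<Delta> Sig Conj (Arrow Omicron (Arrow Omicron Omicron))"
| Disj: "has_type \<Delta> Sig Disj (Arrow Omicron (Arrow Omicron Omicron))"
| Ex: "argument_type \<tau> \<Longrightarrow> has_type \<Delta> Sig (Ex \<tau>) (Arrow (Arrow \<tau> Omicron) Omicron)"
| App: "has_type \<Delta> Sig M (Arrow \<sigma>\<^sub>1 \<sigma>\<^sub>2) \<Longrightarrow> has_type \<Delta> Sig N \<sigma>\<^sub>1 \<Longrightarrow> has_type \<Delta> Sig (App M N) \<sigma>\<^sub>2"
| Lam: "has_type \<Delta> Sig M \<rho> \<Longrightarrow> relational \<rho> \<Longrightarrow> has_type \<Delta> Sig (Lam x M) (Arrow (\<Delta> x) \<rho>)"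

definition type_of :: "('x \<Rightarrow> ty) \<Rightarrow> ('c \<Rightarrow> ty option) \<Rightarrow> ('x, 'c) tm \<Rightarrow> ty" where
  "type_of \<Delta> Sig M = (THE \<sigma>. has_type \<Delta> Sig M \<sigma>)"

fun pos_existential :: "('x, 'c) tm \<Rightarrow> bool" where
  "pos_existential (Neg M) = False"
| "pos_existential (App M N) = (pos_existential M \<and> pos_existential N)"
| "pos_existential (Lam x M) = pos_existential M"
| "pos_existential _ = True"

fun no_logical_symbol :: "('x, 'c) tm \<Rightarrow> bool" where
  "no_logical_symbol (Var x) = True"
| "no_logical_symbol (Con c) = True"
| "no_logical_symbol (App M N) = (no_logical_symbol M \<and> no_logical_symbol N)"
| "no_logical_symbol (Lam x M) = no_logical_symbol M"
| "no_logical_symbol _ = False"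


section \<open>Frames, structures and denotations\<close>

definition min_fun :: "'u::zermelo" where
  "min_fun = vlam bools (\<lambda>a. vlam bools (\<lambda>b. tv (a = tru \<and> b = tru)))"

definition max_fun :: "'u::zermelo" where
  "max_fun = vlam bools (\<lambda>a. vlam bools (\<lambda>b. tv (a = tru \<or> b = tru)))"

definition ex_fun :: "(ty \<Rightarrow> 'u::zermelo) \<Rightarrow> ty \<Rightarrow> 'u" where
  "ex_fun H \<tau> = vlam (H (Arrow \<tau> Omicron)) (\<lambda>r. tv (\<exists>s \<in> elts (H \<tau>). r \<bullet> s = tru))"

definition pre_frame :: "(ty \<Rightarrow> 'u::zermelo) \<Rightarrow> bool" where
  "pre_frame H \<longleftrightarrow>
     (\<forall>\<sigma>. is_type \<sigma> \<longrightarrow> elts (H \<sigma>) \<noteq> {}) \<and>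
     H Omicron = bools \<and>
     (\<forall>\<tau> \<sigma>. is_type (Arrow \<tau> \<sigma>) \<longrightarrow> elts (H (Arrow \<tau> \<sigma>)) \<subseteq> elts (vfun (H \<tau>) (H \<sigma>))) \<and>
     min_fun \<in> elts (H (Arrow Omicron (Arrow Omicron Omicron))) \<and>
     max_fun \<in> elts (H (Arrow Omicron (Arrow Omicron Omicron))) \<and>
     (\<forall>\<tau>. argument_type \<tau> \<longrightarrow> ex_fun H \<tau> \<in> elts (H (Arrow (Arrow \<tau> Omicron) Omicron)))"

definition struct :: "('c \<Rightarrow> ty option) \<Rightarrow> (ty \<Rightarrow> 'u::zermelo) \<Rightarrow> ('c \<Rightarrow> 'u) \<Rightarrow> bool" where
  "struct Sig H B \<longleftrightarrow> (\<forall>c \<sigma>. Sig c = Some \<sigma> \<longrightarrow> B c \<in> elts (H \<sigma>))"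

definition valuation :: "('x \<Rightarrow> ty) \<Rightarrow> (ty \<Rightarrow> 'u::zermelo) \<Rightarrow> ('x \<Rightarrow> 'u) \<Rightarrow> bool" where
  "valuation \<Delta> H \<alpha> \<longleftrightarrow> (\<forall>x. \<alpha> x \<in> elts (H (\<Delta> x)))"

primrec den :: "('x \<Rightarrow> ty) \<Rightarrow> ('c \<Rightarrow> ty option) \<Rightarrow> (ty \<Rightarrow> 'u::zermelo) \<Rightarrow> ('c \<Rightarrow> 'u) \<Rightarrow>
    ('x, 'c) tm \<Rightarrow> ('x \<Rightarrow> 'u) \<Rightarrow> 'u" where
  "den \<Delta> Sig H B (Var x) \<alpha> = \<alpha> x"
| "den \<Delta> Sig H B (Con c) \<alpha> = B c"
| "den \<Delta> Sig H B (Neg M) \<alpha> = tv (den \<Delta> Sig H B M \<alpha> = fls)"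
| "den \<Delta> Sig H B Conj \<alpha> = min_fun"
| "den \<Delta> Sig H B Disj \<alpha> = max_fun"
| "den \<Delta> Sig H B (Ex \<tau>) \<alpha> = ex_fun H \<tau>"
| "den \<Delta> Sig H B (App M N) \<alpha> = den \<Delta> Sig H B M \<alpha> \<bullet> den \<Delta> Sig H B N \<alpha>"
| "den \<Delta> Sig H B (Lam x M) \<alpha> =
     (let f = vlam (H (\<Delta> x)) (\<lambda>r. den \<Delta> Sig H B M (\<alpha>(x := r)));
          F = H (Arrow (\<Delta> x) (type_of \<Delta> Sig M))
      in if f \<in> elts F then f else (SOME g. g \<in> elts F))"

text \<open>
  Comprehension is required for all signatures. A term mentions only finitely many symbols, so it
  suffices to take the symbols to be natural numbers.
\<close>

definition frame :: "('x \<Rightarrow> ty) \<Rightarrow> (ty \<Rightarrow> 'u::zermelo) \<Rightarrow> bool" where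
  "frame \<Delta> H \<longleftrightarrow> pre_frame H \<and>
     (\<forall>(Sig :: nat \<Rightarrow> ty option) B \<alpha> x M \<rho>.
        signature Sig \<longrightarrow> struct Sig H B \<longrightarrow> valuation \<Delta> H \<alpha> \<longrightarrow>
        has_type \<Delta> Sig (Lam x M) (Arrow (\<Delta> x) \<rho>) \<longrightarrow> pos_existential (Lam x M) \<longrightarrow>
        den \<Delta> Sig H B (Lam x M) \<alpha> = vlam (H (\<Delta> x)) (\<lambda>r. den \<Delta> Sig H B M (\<alpha>(x := r))))"

text \<open>
  On functions, the domain is read off the left argument; for members of a frame at type
  \<open>Arrow \<tau> \<sigma>\<close> it is always \<open>elts (H \<tau>)\<close>.
\<close>

fun le :: "ty \<Rightarrow> 'u::zermelo \<Rightarrow> 'u \<Rightarrow> bool" where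
  "le Iota a b = (a = b)"
| "le Omicron a b = (a = fls \<or> b = tru)"
| "le (Arrow \<tau> \<sigma>) f g = (\<forall>x \<in> vdom f. le \<sigma> (f \<bullet> x) (g \<bullet> x))"

text \<open>The pointwise least upper bound, meaningful at relational types only.\<close>

fun pointwise_lub :: "(ty \<Rightarrow> 'u::zermelo) \<Rightarrow> ty \<Rightarrow> 'u set \<Rightarrow> 'u" where
  "pointwise_lub H Iota R = undefined"
| "pointwise_lub H Omicron R = tv (tru \<in> R)"
| "pointwise_lub H (Arrow \<tau> \<rho>) R =
     vlam (H \<tau>) (\<lambda>s. pointwise_lub H \<rho> ((\<lambda>f. f \<bullet> s) ` R))"

definition complete_frame :: "('x \<Rightarrow> ty) \<Rightarrow> (ty \<Rightarrow> 'u::zermelo) \<Rightarrow> bool" where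
  "complete_frame \<Delta> H \<longleftrightarrow> frame \<Delta> H \<and>
     (\<forall>\<rho> R. relational \<rho> \<longrightarrow> R \<subseteq> elts (H \<rho>) \<longrightarrow> pointwise_lub H \<rho> R \<in> elts (H \<rho>))"

primrec standard_frame :: "'u::zermelo \<Rightarrow> ty \<Rightarrow> 'u" where
  "standard_frame D Iota = D"
| "standard_frame D Omicron = bools"
| "standard_frame D (Arrow \<tau> \<sigma>) = vfun (standard_frame D \<tau>) (standard_frame D \<sigma>)"

primrec monotone_frame :: "'u::zermelo \<Rightarrow> ty \<Rightarrow> 'u" where
  "monotone_frame D Iota = D"
| "monotone_frame D Omicron = bools"
| "monotone_frame D (Arrow \<tau> \<sigma>) =
     vset {f \<in> elts (vfun (monotone_frame D \<tau>) (monotone_frame D \<sigma>)).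
       \<forall>x \<in> elts (monotone_frame D \<tau>). \<forall>y \<in> elts (monotone_frame D \<tau>).
         le \<tau> x y \<longrightarrow> le \<sigma> (f \<bullet> x) (f \<bullet> y)}"

definition directed :: "('u \<Rightarrow> 'u \<Rightarrow> bool) \<Rightarrow> 'u set \<Rightarrow> bool" where
  "directed r X \<longleftrightarrow> X \<noteq> {} \<and> (\<forall>x \<in> X. \<forall>y \<in> X. \<exists>z \<in> X. r x z \<and> r y z)"

definition is_lub :: "('u \<Rightarrow> 'u \<Rightarrow> bool) \<Rightarrow> 'u set \<Rightarrow> 'u set \<Rightarrow> 'u \<Rightarrow> bool" where
  "is_lub r P X s \<longleftrightarrow> s \<in> P \<and> (\<forall>x \<in> X. r x s) \<and>
     (\<forall>u \<in> P. (\<forall>x \<in> X. r x u) \<longrightarrow> r s u)"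

definition scott_continuous ::
  "('u \<Rightarrow> 'u \<Rightarrow> bool) \<Rightarrow> 'u set \<Rightarrow> ('v \<Rightarrow> 'v \<Rightarrow> bool) \<Rightarrow> 'v set \<Rightarrow> ('u \<Rightarrow> 'v) \<Rightarrow> bool" where
  "scott_continuous r P r' Q f \<longleftrightarrow>
     (\<forall>X s. X \<subseteq> P \<longrightarrow> directed r X \<longrightarrow> is_lub r P X s \<longrightarrow> is_lub r' Q (f ` X) (f s))"

primrec continuous_frame :: "'u::zermelo \<Rightarrow> ty \<Rightarrow> 'u" where
  "continuous_frame D Iota = D"
| "continuous_frame D Omicron = bools"
| "continuous_frame D (Arrow \<tau> \<sigma>) =
     vset {f \<in> elts (vfun (continuous_frame D \<tau>) (continuous_frame D \<sigma>)).
       scott_continuous (le \<tau>) (elts (continuous_frame D \<tau>))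
         (le \<sigma>) (elts (continuous_frame D \<sigma>)) (\<lambda>x. f \<bullet> x)}"


section \<open>Expansions of a first-order structure, clauses and satisfiability\<close>

text \<open>
  A first-order structure consists of a nonempty set \<open>D\<close> interpreting \<open>Iota\<close> and an interpretation
  \<open>A\<close> of the symbols of the signature.
\<close>

definition fo_structure :: "('c \<Rightarrow> ty option) \<Rightarrow> 'u::zermelo \<Rightarrow> ('c \<Rightarrow> 'u) \<Rightarrow> bool" where
  "fo_structure Sig D A \<longleftrightarrow> elts D \<noteq> {} \<and> struct Sig (standard_frame D) A"

definition expands :: "('c \<Rightarrow> ty option) \<Rightarrow> 'u::zermelo \<Rightarrow> ('c \<Rightarrow> 'u) \<Rightarrow> (ty \<Rightarrow> 'u) \<Rightarrow> bool" where
  "expands Sig D A H \<longleftrightarrow> H Iota = D \<and> (\<forall>c \<sigma>. Sig c = Some \<sigma> \<longrightarrow> A c \<in> elts (H \<sigma>))"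

definition expansion :: "('c \<Rightarrow> ty option) \<Rightarrow> ('c \<Rightarrow> ty option) \<Rightarrow> ('c \<Rightarrow> 'u::zermelo) \<Rightarrow>
    (ty \<Rightarrow> 'u) \<Rightarrow> ('c \<Rightarrow> 'u) \<Rightarrow> bool" where
  "expansion Sig Sig' A H B \<longleftrightarrow> struct Sig' H B \<and> (\<forall>c \<in> dom Sig. B c = A c)"

text \<open>
  A clause is the list of its disjuncts: the empty goal clause is allowed, and the term language
  has no constant for falsity.
\<close>

type_synonym ('x, 'c) clause = "('x, 'c) tm list"

definition atom :: "('x \<Rightarrow> ty) \<Rightarrow> ('c \<Rightarrow> ty option) \<Rightarrow> ('x, 'c) tm \<Rightarrow> bool" where
  "atom \<Delta> Sig' M \<longleftrightarrow> has_type \<Delta> Sig' M Omicron \<and> no_logical_symbol M"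

definition goal_clause :: "('x \<Rightarrow> ty) \<Rightarrow> ('c \<Rightarrow> ty option) \<Rightarrow> ('x, 'c) clause \<Rightarrow> bool" where
  "goal_clause \<Delta> Sig' C \<longleftrightarrow> (\<exists>As. (\<forall>M \<in> set As. atom \<Delta> Sig' M) \<and> C = map Neg As)"

definition definite_clause :: "('x \<Rightarrow> ty) \<Rightarrow> ('c \<Rightarrow> ty option) \<Rightarrow> ('c \<Rightarrow> ty option) \<Rightarrow>
    ('x, 'c) clause \<Rightarrow> bool" where
  "definite_clause \<Delta> Sig Sig' C \<longleftrightarrow>
     (\<exists>G R xs. goal_clause \<Delta> Sig' G \<and> R \<in> dom Sig' - dom Sig \<and> distinct xs \<and>
        has_type \<Delta> Sig' (foldl App (Con R) (map Var xs)) Omicron \<and>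
        C = G @ [foldl App (Con R) (map Var xs)])"

definition hochc :: "('x \<Rightarrow> ty) \<Rightarrow> ('c \<Rightarrow> ty option) \<Rightarrow> ('c \<Rightarrow> ty option) \<Rightarrow>
    ('x, 'c) clause \<Rightarrow> bool" where
  "hochc \<Delta> Sig Sig' C \<longleftrightarrow> goal_clause \<Delta> Sig' C \<or> definite_clause \<Delta> Sig Sig' C"

definition models :: "('x \<Rightarrow> ty) \<Rightarrow> ('c \<Rightarrow> ty option) \<Rightarrow> (ty \<Rightarrow> 'u::zermelo) \<Rightarrow> ('c \<Rightarrow> 'u) \<Rightarrow>
    ('x, 'c) clause \<Rightarrow> bool" where
  "models \<Delta> Sig' H B C \<longleftrightarrow>
     (\<forall>\<alpha>. valuation \<Delta> H \<alpha> \<longrightarrow> (\<exists>F \<in> set C. den \<Delta> Sig' H B F \<alpha> = tru))"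

definition satisfiable_in :: "('x \<Rightarrow> ty) \<Rightarrow> ('c \<Rightarrow> ty option) \<Rightarrow> ('c \<Rightarrow> ty option) \<Rightarrow>
    ('c \<Rightarrow> 'u::zermelo) \<Rightarrow> (ty \<Rightarrow> 'u) \<Rightarrow> ('x, 'c) clause set \<Rightarrow> bool" where
  "satisfiable_in \<Delta> Sig Sig' A H \<Gamma> \<longleftrightarrow>
     (\<exists>B. expansion Sig Sig' A H B \<and> (\<forall>C \<in> \<Gamma>. models \<Delta> Sig' H B C))"

definition standard_satisfiable where
  "standard_satisfiable \<Delta> Sig Sig' D A \<Gamma> \<longleftrightarrow> satisfiable_in \<Delta> Sig Sig' A (standard_frame D) \<Gamma>"

definition monotone_satisfiable where
  "monotone_satisfiable \<Delta> Sig Sig' D A \<Gamma> \<longleftrightarrow> satisfiable_in \<Delta> Sig Sig' A (monotone_frame D) \<Gamma>"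

definition continuous_satisfiable where
  "continuous_satisfiable \<Delta> Sig Sig' D A \<Gamma> \<longleftrightarrow>
     satisfiable_in \<Delta> Sig Sig' A (continuous_frame D) \<Gamma>"

definition henkin_satisfiable where
  "henkin_satisfiable \<Delta> Sig Sig' D A \<Gamma> \<longleftrightarrow>
     (\<exists>H. frame \<Delta> H \<and> expands Sig D A H \<and> satisfiable_in \<Delta> Sig Sig' A H \<Gamma>)"

end

theory Submission
  imports Defs
begin

text \<open>
  Let \<open>B\<close> be a model of the clauses in a frame \<open>H\<close>, and let \<open>H'\<close> be a complete frame over the same
  individuals. Compare elements of \<open>H'\<close> and \<open>H\<close> by the logical relation that is equality on
  individuals and implication on truth values, and interpret every relational symbol \<open>R\<close> in \<open>H'\<close> by
  the supremum of all elements related to \<open>B R\<close>. This supremum is itself related to \<open>B R\<close>, so every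
  atom that is true in the new structure is true in \<open>B\<close> under any related valuation; a related
  valuation always exists, because \<open>H\<close> has a greatest element at every relational type. Hence goal
  clauses are inherited. The body of a definite clause for \<open>R\<close>, abstracted over the arguments of
  \<open>R\<close>, is an element of \<open>H'\<close> by comprehension, and it is related to \<open>B R\<close> since \<open>B\<close> satisfies the
  clause; so it lies below the supremum, which is the clause in \<open>H'\<close>. Satisfiability in one frame
  thus implies satisfiability in every complete frame, and the standard, monotone and continuous
  frames are complete.
\<close>

section \<open>Functions in the universe\<close>

text \<open>Existence comes from separation and uniqueness from extensionality. Each later use of
  \<open>vset\<close> has to exhibit a set that bounds the collection.\<close>

lemma elts_vset: "X \<subseteq> elts a \<Longrightarrow> elts (vset X) = X"
  unfolding vset_def by (metis (mono_tags, lifting) extensionality separation theI)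

lemma elts_vset_insert2 [simp]: "elts (vset {a, b}) = {a, b}"
  by (metis elts_vset order_refl pairing)

lemma elts_vset_singleton [simp]: "elts (vset {a}) = {a}"
  using elts_vset_insert2[of a a] by simp

lemma vset_insert2_eq_iff: "vset {a, b} = vset {c, d} \<longleftrightarrow> {a, b} = {c, d}"
  by (metis elts_vset_insert2)

lemma vpair_eq_iff [simp]: "vpair a b = vpair c d \<longleftrightarrow> a = c \<and> b = d"
proof -
  have "vset {x} = vset {x, x}" for x :: 'a
    by simp
  then show ?thesis
    unfolding vpair_def
    by (smt (verit, best) doubleton_eq_iff vset_insert2_eq_iff)
qed

lemma ex_binary_union: "\<exists>c. elts a \<union> elts b \<subseteq> elts c"
proof -
  obtain p where "elts p = {a, b}"
    using pairing by blast
  then show ?thesis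
    using union[of p] by auto
qed

text \<open>Kuratowski pairs over \<open>a\<close> and \<open>b\<close> belong to the double power
  set of the union. This bounds the graphs of all functions from \<open>a\<close> to
  \<open>b\<close>.\<close>

lemma ex_pairs: "\<exists>p. \<forall>x\<in>elts a. \<forall>y\<in>elts b. vpair x y \<in> elts p"
proof -
  obtain c where c: "elts a \<union> elts b \<subseteq> elts c"
    using ex_binary_union by blast
  obtain d where d: "elts d = {x. elts x \<subseteq> elts c}"
    using powerset by blast
  obtain e where e: "elts e = {x. elts x \<subseteq> elts d}"
    using powerset by blast
  have "vpair x y \<in> elts e" if "x \<in> elts a" "y \<in> elts b" for x y
    using that c d unfolding e vpair_def by auto
  then show ?thesis
    by blast
qed

text \<open>The axioms include no replacement, so the graph of a HOL function is sure to be a set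
  only when its values are bounded by some \<open>B\<close>. Hence the codomain premise wherever
  \<open>vlam\<close> is computed with.\<close>

lemma elts_vlam:
  assumes "\<And>x. x \<in> elts A \<Longrightarrow> f x \<in> elts B"
  shows "elts (vlam A f) = {vpair x (f x) | x. x \<in> elts A}"
proof -
  obtain p where "\<forall>x\<in>elts A. \<forall>y\<in>elts B. vpair x y \<in> elts p"
    using ex_pairs by blast
  with assms have "{vpair x (f x) | x. x \<in> elts A} \<subseteq> elts p"
    by blast
  then show ?thesis
    unfolding vlam_def by (rule elts_vset)
qed

lemma vapp_vlam:
  assumes "\<And>x. x \<in> elts A \<Longrightarrow> f x \<in> elts B" and "x \<in> elts A"
  shows "vlam A f \<bullet> x = f x"
  unfolding vapp_def using assms(2) by (auto simp: elts_vlam[of A f, OF assms(1)])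

lemma vlam_cong: "(\<And>x. x \<in> elts A \<Longrightarrow> f x = g x) \<Longrightarrow> vlam A f = vlam A g"
  unfolding vlam_def by (metis (mono_tags, lifting))

lemma elts_vfun: "elts (vfun A B) = {vlam A f | f. \<forall>x\<in>elts A. f x \<in> elts B}"
proof -
  obtain p where p: "\<forall>x\<in>elts A. \<forall>y\<in>elts B. vpair x y \<in> elts p"
    using ex_pairs by blast
  obtain q where q: "elts q = {x. elts x \<subseteq> elts p}"
    using powerset by blast
  have "{vlam A f | f. \<forall>x\<in>elts A. f x \<in> elts B} \<subseteq> elts q"
  proof clarify
    fix f assume "\<forall>x\<in>elts A. f x \<in> elts B"
    then have "elts (vlam A f) = {vpair x (f x) | x. x \<in> elts A}"
      by (intro elts_vlam[where B = B]) simp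
    with p \<open>\<forall>x\<in>elts A. f x \<in> elts B\<close> show "vlam A f \<in> elts q"
      unfolding q by auto
  qed
  then show ?thesis
    unfolding vfun_def by (rule elts_vset)
qed

lemma vlam_in_vfun: "(\<And>x. x \<in> elts A \<Longrightarrow> f x \<in> elts B) \<Longrightarrow> vlam A f \<in> elts (vfun A B)"
  unfolding elts_vfun by blast

lemma vapp_in:
  assumes "f \<in> elts (vfun A B)" and "x \<in> elts A"
  shows "f \<bullet> x \<in> elts B"
  using assms unfolding elts_vfun by (auto simp: vapp_vlam[where B = B])

lemma vdom_vlam:
  assumes "\<And>x. x \<in> elts A \<Longrightarrow> f x \<in> elts B"
  shows "vdom (vlam A f) = elts A"
  unfolding vdom_def by (auto simp: elts_vlam[of A f, OF assms])

lemma vdom_vfun: "f \<in> elts (vfun A B) \<Longrightarrow> vdom f = elts A"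
  unfolding elts_vfun by (auto simp: vdom_vlam[where B = B])

lemma vlam_eta: "f \<in> elts (vfun A B) \<Longrightarrow> vlam A (\<lambda>x. f \<bullet> x) = f"
  unfolding elts_vfun by (auto simp: vapp_vlam[where B = B] intro!: vlam_cong)

lemma vfun_ext:
  assumes "f \<in> elts (vfun A B)" "g \<in> elts (vfun A B)"
    and "\<And>x. x \<in> elts A \<Longrightarrow> f \<bullet> x = g \<bullet> x"
  shows "f = g"
  by (metis assms vlam_cong vlam_eta)

section \<open>Truth values and the logical constants\<close>

lemma elts_bools [simp]: "elts bools = {fls, tru}"
  by (simp add: bools_def)

lemma tru_neq_fls [simp]: "tru \<noteq> (fls :: 'a::zermelo)" "fls \<noteq> (tru :: 'a)"
proof -
  have "elts (fls :: 'a) = {}"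
    unfolding fls_def by (rule elts_vset) simp
  moreover have "elts (tru :: 'a) = {fls}"
    unfolding tru_def by simp
  ultimately have "tru \<noteq> (fls :: 'a)"
    by auto
  then show "tru \<noteq> (fls :: 'a)" "fls \<noteq> (tru :: 'a)"
    by auto
qed

lemma tv_eq_tru [simp]: "tv P = tru \<longleftrightarrow> P"
  by (simp add: tv_def)

lemma tv_eq_fls [simp]: "tv P = fls \<longleftrightarrow> \<not> P"
  by (simp add: tv_def)

lemma tv_in_bools: "tv P \<in> elts bools"
  by (simp add: tv_def)

lemma tv_cases: "tv P = fls \<or> tv P = tru"
  by (simp add: tv_def)

lemma min_fun_apply:
  assumes "a \<in> elts bools" "b \<in> elts bools"
  shows "min_fun \<bullet> a \<bullet> b = tv (a = tru \<and> b = tru)"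
  unfolding min_fun_def
  by (subst vapp_vlam[where B = "vfun bools bools"] vapp_vlam[where B = bools],
      use assms in \<open>auto intro!: vlam_in_vfun tv_in_bools simp del: elts_bools\<close>)+

lemma ex_fun_apply:
  "r \<in> elts (H (Arrow \<tau> Omicron)) \<Longrightarrow> ex_fun H \<tau> \<bullet> r = tv (\<exists>s \<in> elts (H \<tau>). r \<bullet> s = tru)"
  unfolding ex_fun_def by (rule vapp_vlam[where B = bools]) (auto simp: tv_cases)

section \<open>Typing\<close>

text \<open>\<open>\<Delta>\<close> fixes the type of every variable, so no type is guessed at an
  abstraction. This makes the description in \<open>type_of\<close> proper.\<close>

lemma has_type_unique:
  "has_type \<Delta> Sig M \<sigma> \<Longrightarrow> has_type \<Delta> Sig M \<sigma>' \<Longrightarrow> \<sigma> = \<sigma>'"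
proof (induction arbitrary: \<sigma>' rule: has_type.induct)
  case (App M \<sigma>\<^sub>1 \<sigma>\<^sub>2 N)
  from App.prems App.IH(1) show ?case
    by (cases rule: has_type.cases) auto
next
  case (Lam M \<rho> x)
  from Lam.prems Lam.IH show ?case
    by (cases rule: has_type.cases) auto
qed (erule has_type.cases; simp)+

lemma type_of_eq: "has_type \<Delta> Sig M \<sigma> \<Longrightarrow> type_of \<Delta> Sig M = \<sigma>"
  unfolding type_of_def using has_type_unique by blast

lemma relational_is_type: "relational \<sigma> \<Longrightarrow> is_type \<sigma>"
  by (simp add: is_type_def)

lemma argument_is_type: "argument_type \<sigma> \<Longrightarrow> is_type \<sigma>"
  by (auto simp: is_type_def argument_type_def)

lemma relational_Arrow: "relational (Arrow \<tau> \<rho>) \<longleftrightarrow> argument_type \<tau> \<and> relational \<rho>"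
  by (simp add: argument_type_def)

lemma is_type_ArrowD: "is_type (Arrow \<sigma>\<^sub>1 \<sigma>\<^sub>2) \<Longrightarrow> argument_type \<sigma>\<^sub>1 \<and> is_type \<sigma>\<^sub>2"
  by (auto simp: is_type_def argument_type_def)

lemma has_type_is_type:
  assumes "type_env \<Delta>" "signature Sig"
  shows "has_type \<Delta> Sig M \<sigma> \<Longrightarrow> is_type \<sigma>"
proof (induction rule: has_type.induct)
  case (Var x)
  then show ?case
    using assms(1) by (simp add: type_env_def argument_is_type)
next
  case (Con c \<sigma>)
  then show ?case
    using assms(2) by (simp add: signature_def)
next
  case (Ex \<tau>)
  then show ?case
    by (simp add: is_type_def argument_type_def)
next
  case (App M \<sigma>\<^sub>1 \<sigma>\<^sub>2 N)
  then show ?case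
    using is_type_ArrowD by blast
next
  case (Lam M \<rho> x)
  then show ?case
    using assms(1) by (simp add: type_env_def relational_Arrow relational_is_type del: relational.simps)
qed (simp_all add: is_type_def)

section \<open>Renaming of symbols\<close>

lemma has_type_map_tm:
  "has_type \<Delta> Sig (map_tm (\<lambda>x. x) h M) \<sigma> \<longleftrightarrow> has_type \<Delta> (Sig \<circ> h) M \<sigma>"
proof
  show "has_type \<Delta> (Sig \<circ> h) M \<sigma> \<Longrightarrow> has_type \<Delta> Sig (map_tm (\<lambda>x. x) h M) \<sigma>"
    by (induction rule: has_type.induct) (auto intro: has_type.intros)
  show "has_type \<Delta> Sig (map_tm (\<lambda>x. x) h M) \<sigma> \<Longrightarrow> has_type \<Delta> (Sig \<circ> h) M \<sigma>"
  proof (induction M arbitrary: \<sigma>)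
    case (Lam x M)
    from Lam.prems Lam.IH show ?case
      by (cases rule: has_type.cases) (auto intro: has_type.intros)
  next
    case (App M N)
    from App.prems App.IH show ?case
      by (cases rule: has_type.cases) (auto intro: has_type.intros)
  qed (erule has_type.cases; auto intro: has_type.intros)+
qed

text \<open>At an abstraction, the default branch of \<open>den\<close> depends on the type of the
  body. Renaming preserves that type, so both sides choose the same element.\<close>

lemma den_map_tm:
  "den \<Delta> Sig H B (map_tm (\<lambda>x. x) h M) \<alpha> = den \<Delta> (Sig \<circ> h) H (B \<circ> h) M \<alpha>"
proof (induction M arbitrary: \<alpha>)
  case (Lam x M)
  have "type_of \<Delta> Sig (map_tm (\<lambda>x. x) h M) = type_of \<Delta> (Sig \<circ> h) M"
    by (simp add: type_of_def has_type_map_tm)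
  with Lam show ?case
    by (simp add: comp_def fun_upd_def)
qed simp_all

lemma pos_existential_map_tm: "pos_existential (map_tm (\<lambda>x. x) h M) = pos_existential M"
  by (induction M) simp_all

lemma no_logical_symbol_pos_existential: "no_logical_symbol M \<Longrightarrow> pos_existential M"
  by (induction M) simp_all

lemma finite_set2_tm: "finite (set2_tm M)"
  by (induction M) simp_all

text \<open>The finitely many symbols of \<open>M\<close> are enumerated and renamed back. This
  carries comprehension, which \<open>frame\<close> demands for natural numbers as symbols, to every
  type of symbols.\<close>

lemma ex_map_tm_nat: "\<exists>(h :: nat \<Rightarrow> 'c) M'. M = map_tm (\<lambda>x. x) h M'"
proof -
  obtain n and h :: "nat \<Rightarrow> 'c" where h: "set2_tm M = h ` {i. i < n}"
    using finite_imp_nat_seg_image_inj_on[OF finite_set2_tm] by metis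
  \<comment> \<open>A right inverse of \<open>h\<close> on the symbols of \<open>M\<close>.\<close>
  let ?g = "inv_into {i. i < n} h"
  have "map_tm (\<lambda>x. x) h (map_tm (\<lambda>x. x) ?g M) = M"
    unfolding tm.map_comp
    by (rule trans[OF tm.map_cong0 tm.map_ident]) (auto simp: h f_inv_into_f)
  then show ?thesis
    by metis
qed

section \<open>Comprehension\<close>

lemma pre_frame_frame: "frame \<Delta> H \<Longrightarrow> pre_frame H"
  by (simp add: frame_def)

lemma frame_Omicron: "frame \<Delta> H \<Longrightarrow> H Omicron = bools"
  by (simp add: frame_def pre_frame_def)

lemma frame_Arrow:
  "frame \<Delta> H \<Longrightarrow> is_type (Arrow \<tau> \<sigma>) \<Longrightarrow> f \<in> elts (H (Arrow \<tau> \<sigma>)) \<Longrightarrow> f \<in> elts (vfun (H \<tau>) (H \<sigma>))"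
  by (auto simp: frame_def pre_frame_def)

lemma frame_vapp:
  "frame \<Delta> H \<Longrightarrow> is_type (Arrow \<tau> \<sigma>) \<Longrightarrow> f \<in> elts (H (Arrow \<tau> \<sigma>)) \<Longrightarrow> s \<in> elts (H \<tau>) \<Longrightarrow>
    f \<bullet> s \<in> elts (H \<sigma>)"
  by (blast dest: frame_Arrow vapp_in)

lemma valuation_upd: "valuation \<Delta> H \<alpha> \<Longrightarrow> r \<in> elts (H (\<Delta> x)) \<Longrightarrow> valuation \<Delta> H (\<alpha>(x := r))"
  by (simp add: valuation_def)

text \<open>Signature and interpretation are pulled back along the enumeration \<open>h\<close>,
  where the comprehension of \<open>frame\<close> applies.\<close>

lemma frame_den_Lam:
  fixes M :: "('x, 'c) tm"
  assumes "frame \<Delta> H" "signature Sig" "struct Sig H B" "valuation \<Delta> H \<alpha>"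
    and "has_type \<Delta> Sig (Lam x M) (Arrow (\<Delta> x) \<rho>)" "pos_existential M"
  shows "den \<Delta> Sig H B (Lam x M) \<alpha> = vlam (H (\<Delta> x)) (\<lambda>r. den \<Delta> Sig H B M (\<alpha>(x := r)))"
proof -
  obtain h :: "nat \<Rightarrow> 'c" and M' where M: "M = map_tm (\<lambda>x. x) h M'"
    using ex_map_tm_nat by blast
  then have L: "Lam x M = map_tm (\<lambda>x. x) h (Lam x M')"
    by simp
  have "signature (Sig \<circ> h)" "struct (Sig \<circ> h) H (B \<circ> h)"
    using assms(2,3) by (simp_all add: signature_def struct_def)
  moreover have "has_type \<Delta> (Sig \<circ> h) (Lam x M') (Arrow (\<Delta> x) \<rho>)"
    using assms(5) unfolding L has_type_map_tm .
  moreover have "pos_existential (Lam x M')"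
    using assms(6) unfolding M pos_existential_map_tm by simp
  ultimately show ?thesis
    using assms(1,4) unfolding L den_map_tm unfolding M den_map_tm frame_def by blast
qed

text \<open>At an abstraction both branches of \<open>den\<close> lead into the frame, the default
  one because the set at that type is nonempty.\<close>

lemma frame_den_in:
  assumes "type_env \<Delta>" "frame \<Delta> H" "signature Sig" "struct Sig H B"
  shows "has_type \<Delta> Sig M \<sigma> \<Longrightarrow> pos_existential M \<Longrightarrow> valuation \<Delta> H \<alpha> \<Longrightarrow>
    den \<Delta> Sig H B M \<alpha> \<in> elts (H \<sigma>)"
proof (induction arbitrary: \<alpha> rule: has_type.induct)
  case (App M \<sigma>\<^sub>1 \<sigma>\<^sub>2 N)
  then show ?case
    using frame_vapp[OF assms(2)] has_type_is_type[OF assms(1,3)] by fastforce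
next
  case (Lam M \<rho> x)
  have "is_type (Arrow (\<Delta> x) \<rho>)"
    using Lam.hyps has_type.Lam has_type_is_type[OF assms(1,3)] by metis
  then have "\<exists>g. g \<in> elts (H (Arrow (\<Delta> x) \<rho>))"
    using assms(2) by (auto simp: frame_def pre_frame_def)
  then show ?case
    by (simp add: Let_def type_of_eq[OF Lam.hyps(1)] some_in_eq ex_in_conv)
qed (use assms in \<open>auto simp: frame_def pre_frame_def valuation_def struct_def\<close>)

lemma frame_vapp_den_Lam:
  assumes "type_env \<Delta>" "frame \<Delta> H" "signature Sig" "struct Sig H B" "valuation \<Delta> H \<alpha>"
    and "has_type \<Delta> Sig M \<rho>" "relational \<rho>" "pos_existential M" "s \<in> elts (H (\<Delta> x))"
  shows "den \<Delta> Sig H B (Lam x M) \<alpha> \<bullet> s = den \<Delta> Sig H B M (\<alpha>(x := s))"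
proof -
  have "den \<Delta> Sig H B (Lam x M) \<alpha> = vlam (H (\<Delta> x)) (\<lambda>r. den \<Delta> Sig H B M (\<alpha>(x := r)))"
    using assms by (intro frame_den_Lam) (auto intro: has_type.Lam)
  moreover have "den \<Delta> Sig H B M (\<alpha>(x := r)) \<in> elts (H \<rho>)" if "r \<in> elts (H (\<Delta> x))" for r
    using assms that by (intro frame_den_in valuation_upd)
  ultimately show ?thesis
    using assms(9) by (simp add: vapp_vlam[where B = "H \<rho>"])
qed

lemma ex_valuation:
  assumes "type_env \<Delta>" "pre_frame H"
  shows "\<exists>\<alpha>. valuation \<Delta> H \<alpha>"
proof -
  have "\<forall>x. \<exists>a. a \<in> elts (H (\<Delta> x))"
    using assms unfolding type_env_def pre_frame_def by (metis all_not_in_conv argument_is_type)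
  then show ?thesis
    unfolding valuation_def by (rule choice)
qed

section \<open>Transfer of models between frames\<close>

text \<open>The left element comes from \<open>H'\<close>, the right one from \<open>H\<close>. At
  relational types this generalizes inclusion to relations over different domains.\<close>

fun approx :: "(ty \<Rightarrow> 'u::zermelo) \<Rightarrow> (ty \<Rightarrow> 'u) \<Rightarrow> ty \<Rightarrow> 'u \<Rightarrow> 'u \<Rightarrow> bool" where
  "approx H' H Iota a b \<longleftrightarrow> a = b"
| "approx H' H Omicron a b \<longleftrightarrow> (a = tru \<longrightarrow> b = tru)"
| "approx H' H (Arrow \<tau> \<sigma>) f g \<longleftrightarrow>
     (\<forall>s' \<in> elts (H' \<tau>). \<forall>s \<in> elts (H \<tau>). approx H' H \<tau> s' s \<longrightarrow> approx H' H \<sigma> (f \<bullet> s') (g \<bullet> s))"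

text \<open>First-order functions take individuals only, and related individuals are equal. So
  background symbols, interpreted alike in both frames, are related. The case \<open>Omicron\<close>
  is the result type of predicates.\<close>

lemma approx_first_order_refl: "first_order \<sigma> \<or> \<sigma> = Omicron \<Longrightarrow> approx H' H \<sigma> a a"
  by (induction \<sigma> arbitrary: a) auto

text \<open>The constant function is the denotation of an abstraction over \<open>x\<close> with
  body \<open>y\<close>, where \<open>y\<close> is assigned \<open>t\<close>. Infinitely many
  variables of each type allow \<open>y \<noteq> x\<close> even when the two types coincide.\<close>

lemma frame_const_fun:
  assumes "type_env \<Delta>" "frame \<Delta> H" "argument_type \<tau>" "relational \<rho>" "t \<in> elts (H \<rho>)"
  shows "vlam (H \<tau>) (\<lambda>_. t) \<in> elts (H (Arrow \<tau> \<rho>))"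
proof -
  have inf: "infinite {x. \<Delta> x = \<tau>}" "infinite {x. \<Delta> x = \<rho>}"
    using assms(1,3,4) by (auto simp: type_env_def argument_type_def)
  then obtain x where x: "\<Delta> x = \<tau>"
    using not_finite_existsD by auto
  obtain y where y: "\<Delta> y = \<rho>" "y \<noteq> x"
    using inf(2) finite_subset[of "{y. \<Delta> y = \<rho>}" "{x}"] by auto
  obtain \<alpha> where "valuation \<Delta> H \<alpha>"
    using ex_valuation[OF assms(1) pre_frame_frame[OF assms(2)]] by blast
  then have \<alpha>: "valuation \<Delta> H (\<alpha>(y := t))"
    using assms(5) y by (simp add: valuation_upd)
  \<comment> \<open>The empty signature suffices, as \<open>t\<close> enters through a
    variable.\<close>
  let ?Sig = "\<lambda>_ :: nat. None" and ?B = "\<lambda>_ :: nat. undefined"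
  have sig: "signature ?Sig" "struct ?Sig H ?B"
    by (simp_all add: signature_def struct_def)
  have ty: "has_type \<Delta> ?Sig (Lam x (Var y)) (Arrow \<tau> \<rho>)"
    using has_type.Lam[OF has_type.Var, of \<Delta> y ?Sig x] assms(4) x y by simp
  have "den \<Delta> ?Sig H ?B (Lam x (Var y)) (\<alpha>(y := t)) = vlam (H \<tau>) (\<lambda>_. t)"
    using frame_den_Lam[OF assms(2) sig \<alpha>, of x "Var y"] ty x y by simp
  then show ?thesis
    using frame_den_in[OF assms(1,2) sig ty _ \<alpha>] by simp
qed

text \<open>The witness is the relation that is constantly \<open>tru\<close>, built by iterating
  constant functions. Letting \<open>r\<close> range over the whole universe spares the induction
  from tracking membership of the values of \<open>r\<close>.\<close>

lemma ex_approx_top: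
  assumes "type_env \<Delta>" "frame \<Delta> H"
  shows "relational \<rho> \<Longrightarrow> \<exists>t \<in> elts (H \<rho>). \<forall>r. approx H' H \<rho> r t"
proof (induction \<rho>)
  case Omicron
  then show ?case
    using frame_Omicron[OF assms(2)] by auto
next
  case (Arrow \<tau> \<rho>)
  then have \<tau>: "argument_type \<tau>" and \<rho>: "relational \<rho>"
    using relational_Arrow by blast+
  then obtain t where t: "t \<in> elts (H \<rho>)" "\<And>r. approx H' H \<rho> r t"
    using Arrow.IH by blast
  have "approx H' H (Arrow \<tau> \<rho>) r (vlam (H \<tau>) (\<lambda>_. t))" for r
    using t by (auto simp: vapp_vlam[where B = "H \<rho>"])
  then show ?case
    using frame_const_fun[OF assms \<tau> \<rho> t(1)] by blast
qed simp

text \<open>Individuals are matched by themselves, relations by the greatest element.\<close>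

lemma ex_approx_argument:
  assumes "type_env \<Delta>" "frame \<Delta> H" "H' Iota = H Iota" "argument_type \<tau>" "a \<in> elts (H' \<tau>)"
  shows "\<exists>b \<in> elts (H \<tau>). approx H' H \<tau> a b"
proof (cases "\<tau> = Iota")
  case False
  then show ?thesis
    using assms ex_approx_top[OF assms(1,2)] unfolding argument_type_def by blast
qed (use assms in auto)

lemma ex_approx_valuation:
  assumes "type_env \<Delta>" "frame \<Delta> H" "H' Iota = H Iota" "valuation \<Delta> H' \<alpha>'"
  shows "\<exists>\<alpha>. valuation \<Delta> H \<alpha> \<and> (\<forall>x. approx H' H (\<Delta> x) (\<alpha>' x) (\<alpha> x))"
proof -
  have "\<forall>x. \<exists>b. b \<in> elts (H (\<Delta> x)) \<and> approx H' H (\<Delta> x) (\<alpha>' x) b"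
    using ex_approx_argument[where H' = H', OF assms(1-3)] assms(1,4)
    unfolding type_env_def valuation_def by meson
  then show ?thesis
    unfolding valuation_def by metis
qed

text \<open>The fundamental lemma of logical relations. Atoms may contain abstractions; there
  comprehension in both frames turns application into an update of the valuation.\<close>

lemma approx_den:
  assumes "type_env \<Delta>" "signature Sig" "frame \<Delta> H" "frame \<Delta> H'"
    and "struct Sig H B" "struct Sig H' B'"
    and B: "\<And>c \<sigma>. Sig c = Some \<sigma> \<Longrightarrow> approx H' H \<sigma> (B' c) (B c)"
  shows "has_type \<Delta> Sig M \<sigma> \<Longrightarrow> no_logical_symbol M \<Longrightarrow>
    valuation \<Delta> H' \<alpha>' \<Longrightarrow> valuation \<Delta> H \<alpha> \<Longrightarrow> (\<And>x. approx H' H (\<Delta> x) (\<alpha>' x) (\<alpha> x)) \<Longrightarrow>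
    approx H' H \<sigma> (den \<Delta> Sig H' B' M \<alpha>') (den \<Delta> Sig H B M \<alpha>)"
proof (induction arbitrary: \<alpha> \<alpha>' rule: has_type.induct)
  case (App M \<sigma>\<^sub>1 \<sigma>\<^sub>2 N)
  have "den \<Delta> Sig H' B' N \<alpha>' \<in> elts (H' \<sigma>\<^sub>1)" "den \<Delta> Sig H B N \<alpha> \<in> elts (H \<sigma>\<^sub>1)"
    using App assms by (auto intro!: frame_den_in no_logical_symbol_pos_existential)
  then show ?case
    using App.IH(1)[of \<alpha>' \<alpha>] App.IH(2)[of \<alpha>' \<alpha>] App.prems by simp
next
  case (Lam M \<rho> x)
  show ?case
    unfolding approx.simps
  proof (intro ballI impI)
    fix s' s assume s: "s' \<in> elts (H' (\<Delta> x))" "s \<in> elts (H (\<Delta> x))" "approx H' H (\<Delta> x) s' s"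
    have "pos_existential M"
      using Lam.prems(1) by (simp add: no_logical_symbol_pos_existential)
    then have "den \<Delta> Sig H' B' (Lam x M) \<alpha>' \<bullet> s' = den \<Delta> Sig H' B' M (\<alpha>'(x := s'))"
      and "den \<Delta> Sig H B (Lam x M) \<alpha> \<bullet> s = den \<Delta> Sig H B M (\<alpha>(x := s))"
      using Lam.hyps Lam.prems assms s by (auto intro!: frame_vapp_den_Lam simp del: den.simps)
    moreover have "approx H' H \<rho> (den \<Delta> Sig H' B' M (\<alpha>'(x := s'))) (den \<Delta> Sig H B M (\<alpha>(x := s)))"
      using Lam.prems s by (intro Lam.IH valuation_upd) auto
    ultimately show "approx H' H \<rho> (den \<Delta> Sig H' B' (Lam x M) \<alpha>' \<bullet> s')
        (den \<Delta> Sig H B (Lam x M) \<alpha> \<bullet> s)"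
      by simp
  qed
qed (use B in simp_all)

section \<open>Suprema in complete frames\<close>

lemma complete_frame_lub_apply:
  assumes "complete_frame \<Delta> H" "relational (Arrow \<tau> \<rho>)" "R \<subseteq> elts (H (Arrow \<tau> \<rho>))" "s \<in> elts (H \<tau>)"
  shows "pointwise_lub H (Arrow \<tau> \<rho>) R \<bullet> s = pointwise_lub H \<rho> ((\<lambda>f. f \<bullet> s) ` R)"
    and "(\<lambda>f. f \<bullet> s) ` R \<subseteq> elts (H \<rho>)"
proof -
  have *: "(\<lambda>f. f \<bullet> s) ` R \<subseteq> elts (H \<rho>)" if "s \<in> elts (H \<tau>)" for s
    using assms that frame_vapp[of \<Delta> H \<tau> \<rho>] relational_is_type
    unfolding complete_frame_def by blast
  then show "(\<lambda>f. f \<bullet> s) ` R \<subseteq> elts (H \<rho>)"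
    using assms(4) .
  have "pointwise_lub H \<rho> ((\<lambda>f. f \<bullet> s) ` R) \<in> elts (H \<rho>)" if "s \<in> elts (H \<tau>)" for s
    using assms(1,2) *[OF that] by (simp add: complete_frame_def)
  then show "pointwise_lub H (Arrow \<tau> \<rho>) R \<bullet> s = pointwise_lub H \<rho> ((\<lambda>f. f \<bullet> s) ` R)"
    using assms(4) by (simp add: vapp_vlam[where B = "H \<rho>"])
qed

text \<open>At \<open>Omicron\<close> a true supremum has a true member, and application commutes
  with pointwise suprema. So the elements related to a fixed \<open>b\<close> are closed under
  suprema.\<close>

lemma approx_pointwise_lub:
  assumes "complete_frame \<Delta> H'"
  shows "relational \<rho> \<Longrightarrow> R \<subseteq> elts (H' \<rho>) \<Longrightarrow> (\<And>r. r \<in> R \<Longrightarrow> approx H' H \<rho> r b) \<Longrightarrow>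
    approx H' H \<rho> (pointwise_lub H' \<rho> R) b"
proof (induction \<rho> arbitrary: R b)
  case (Arrow \<tau> \<rho>)
  show ?case
    unfolding approx.simps
  proof (intro ballI impI)
    fix s' s assume s: "s' \<in> elts (H' \<tau>)" "s \<in> elts (H \<tau>)" "approx H' H \<tau> s' s"
    have "approx H' H \<rho> (pointwise_lub H' \<rho> ((\<lambda>f. f \<bullet> s') ` R)) (b \<bullet> s)"
      using Arrow s complete_frame_lub_apply(2)[OF assms Arrow.prems(1,2) s(1)]
      by (intro Arrow.IH) auto
    then show "approx H' H \<rho> (pointwise_lub H' (Arrow \<tau> \<rho>) R \<bullet> s') (b \<bullet> s)"
      using complete_frame_lub_apply(1)[OF assms Arrow.prems(1,2) s(1)] by simp
  qed
qed auto

section \<open>Iterated abstraction and application\<close>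

abbreviation arrows :: "('x \<Rightarrow> ty) \<Rightarrow> 'x list \<Rightarrow> ty \<Rightarrow> ty" where
  "arrows \<Delta> xs \<rho> \<equiv> foldr (\<lambda>x. Arrow (\<Delta> x)) xs \<rho>"

text \<open>The supremum dominates its members, in the form that the head of a definite clause calls
  for: after application to all arguments.\<close>

lemma pointwise_lub_upper:
  assumes "complete_frame \<Delta> H" "valuation \<Delta> H \<alpha>"
  shows "relational (arrows \<Delta> xs Omicron) \<Longrightarrow> R \<subseteq> elts (H (arrows \<Delta> xs Omicron)) \<Longrightarrow> r \<in> R \<Longrightarrow>
    foldl (\<bullet>) r (map \<alpha> xs) = tru \<Longrightarrow>
    foldl (\<bullet>) (pointwise_lub H (arrows \<Delta> xs Omicron) R) (map \<alpha> xs) = tru"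
proof (induction xs arbitrary: R r)
  case (Cons x xs)
  have x: "\<alpha> x \<in> elts (H (\<Delta> x))"
    using assms(2) by (simp add: valuation_def)
  note app = complete_frame_lub_apply[OF assms(1) Cons.prems(1,2)[simplified foldr.simps comp_def] x]
  have "foldl (\<bullet>) (pointwise_lub H (arrows \<Delta> xs Omicron) ((\<lambda>f. f \<bullet> \<alpha> x) ` R)) (map \<alpha> xs) = tru"
    using Cons.prems app(2) by (intro Cons.IH[of _ "r \<bullet> \<alpha> x"]) auto
  then show ?case
    using app(1) by simp
qed simp

lemma has_type_foldr_Lam:
  assumes "type_env \<Delta>" "has_type \<Delta> Sig M Omicron"
  shows "has_type \<Delta> Sig (foldr Lam xs M) (arrows \<Delta> xs Omicron) \<and> relational (arrows \<Delta> xs Omicron)"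
proof (induction xs)
  case (Cons x xs)
  then show ?case
    using assms(1) by (simp add: has_type.Lam type_env_def argument_type_def)
qed (use assms in simp)

lemma pos_existential_foldr_Lam: "pos_existential (foldr Lam xs M) = pos_existential M"
  by (induction xs) simp_all

lemma has_type_foldl_App:
  "has_type \<Delta> Sig (foldl App M (map Var xs)) \<sigma> \<Longrightarrow> has_type \<Delta> Sig M (arrows \<Delta> xs \<sigma>)"
proof (induction xs arbitrary: M)
  case (Cons x xs)
  then have "has_type \<Delta> Sig (App M (Var x)) (arrows \<Delta> xs \<sigma>)"
    by simp
  then show ?case
    by (auto elim!: has_type.cases[of _ _ "App M (Var x)"] has_type.cases[of _ _ "Var x"])
qed simp

lemma den_foldl_App:
  "den \<Delta> Sig H B (foldl App M (map Var xs)) \<alpha> = foldl (\<bullet>) (den \<Delta> Sig H B M \<alpha>) (map \<alpha> xs)"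
  by (induction xs arbitrary: M) simp_all

context
  fixes \<Delta> :: "'x \<Rightarrow> ty" and Sig :: "'c \<Rightarrow> ty option" and H :: "ty \<Rightarrow> 'u::zermelo" and B :: "'c \<Rightarrow> 'u"
  assumes env: "type_env \<Delta>" and fr: "frame \<Delta> H" and sig: "signature Sig" and st: "struct Sig H B"
begin

lemma vapp_den_foldr_Lam:
  assumes "has_type \<Delta> Sig M Omicron" "pos_existential M" "valuation \<Delta> H \<alpha>" "s \<in> elts (H (\<Delta> x))"
  shows "den \<Delta> Sig H B (foldr Lam (x # xs) M) \<alpha> \<bullet> s = den \<Delta> Sig H B (foldr Lam xs M) (\<alpha>(x := s))"
  unfolding foldr.simps comp_def using has_type_foldr_Lam[OF env assms(1), of xs] assms
  by (intro frame_vapp_den_Lam[OF env fr sig st assms(3)]) (auto simp: pos_existential_foldr_Lam)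

text \<open>Each variable is instantiated by its own value, so the valuation stays the same
  throughout the beta reductions.\<close>

lemma foldl_vapp_den_foldr_Lam:
  assumes "has_type \<Delta> Sig M Omicron" "pos_existential M" "valuation \<Delta> H \<alpha>"
  shows "foldl (\<bullet>) (den \<Delta> Sig H B (foldr Lam xs M) \<alpha>) (map \<alpha> xs) = den \<Delta> Sig H B M \<alpha>"
proof (induction xs)
  case (Cons x xs)
  have "\<alpha> x \<in> elts (H (\<Delta> x))"
    using assms(3) by (simp add: valuation_def)
  then show ?case
    using Cons vapp_den_foldr_Lam[OF assms] by simp
qed simp

text \<open>Uncurrying: relatedness of an iterated abstraction to \<open>b\<close> is tested on
  whole related valuations instead of one argument at a time. The condition that
  \<open>\<beta>\<close> agrees with \<open>\<alpha>\<close> off \<open>xs\<close> records that only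
  the abstracted variables vary; with distinctness it preserves the value of an argument already
  supplied.\<close>

lemma approx_den_foldr_Lam:
  assumes M: "has_type \<Delta> Sig M Omicron" "pos_existential M"
    and H': "frame \<Delta> H'" "H Iota = H' Iota"
  shows "distinct xs \<Longrightarrow> valuation \<Delta> H \<alpha> \<Longrightarrow>
    (\<And>\<beta> \<beta>'. valuation \<Delta> H \<beta> \<Longrightarrow> valuation \<Delta> H' \<beta>' \<Longrightarrow> (\<And>x. approx H H' (\<Delta> x) (\<beta> x) (\<beta>' x)) \<Longrightarrow>
      (\<And>x. x \<notin> set xs \<Longrightarrow> \<beta> x = \<alpha> x) \<Longrightarrow> den \<Delta> Sig H B M \<beta> = tru \<Longrightarrow>
      foldl (\<bullet>) b (map \<beta>' xs) = tru) \<Longrightarrow>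
    approx H H' (arrows \<Delta> xs Omicron) (den \<Delta> Sig H B (foldr Lam xs M) \<alpha>) b"
proof (induction xs arbitrary: \<alpha> b)
  case Nil
  \<comment> \<open>With no argument left, some valuation in \<open>H'\<close> still has to be
    matched with \<open>\<alpha>\<close>.\<close>
  obtain \<beta>' where "valuation \<Delta> H' \<beta>'" "\<And>x. approx H H' (\<Delta> x) (\<alpha> x) (\<beta>' x)"
    using ex_approx_valuation[OF env H' Nil.prems(2)] by blast
  then show ?case
    using Nil.prems(3)[of \<alpha> \<beta>'] Nil.prems(2) by simp
next
  case (Cons x xs)
  have "approx H H' (arrows \<Delta> xs Omicron) (den \<Delta> Sig H B (foldr Lam xs M) (\<alpha>(x := s))) (b \<bullet> s')"
    if s: "s \<in> elts (H (\<Delta> x))" "s' \<in> elts (H' (\<Delta> x))" "approx H H' (\<Delta> x) s s'" for s s'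
  proof (rule Cons.IH)
    show "valuation \<Delta> H (\<alpha>(x := s))"
      using Cons.prems(2) s(1) by (rule valuation_upd)
  next
    fix \<beta> \<beta>'
    assume \<beta>: "valuation \<Delta> H \<beta>" "valuation \<Delta> H' \<beta>'" "\<And>y. approx H H' (\<Delta> y) (\<beta> y) (\<beta>' y)"
      "\<And>y. y \<notin> set xs \<Longrightarrow> \<beta> y = (\<alpha>(x := s)) y" "den \<Delta> Sig H B M \<beta> = tru"
    have x: "x \<notin> set xs"
      using Cons.prems(1) by simp
    then have "\<beta> x = s"
      using \<beta>(4) by simp
    \<comment> \<open>The update makes the first argument \<open>s'\<close>; as \<open>x\<close> is
      not in \<open>xs\<close>, the remaining arguments keep their values.\<close>
    then have "foldl (\<bullet>) b (map (\<beta>'(x := s')) (x # xs)) = tru"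
      using \<beta> s by (intro Cons.prems(3)[OF \<beta>(1)] valuation_upd) auto
    moreover have "map (\<beta>'(x := s')) xs = map \<beta>' xs"
      using x by simp
    ultimately show "foldl (\<bullet>) (b \<bullet> s') (map \<beta>' xs) = tru"
      by (simp del: map_fun_upd fun_upd_apply add: fun_upd_same)
  qed (use Cons.prems in simp)
  then show ?case
    using vapp_den_foldr_Lam[OF M Cons.prems(2)] by simp
qed

text \<open>The body of a definite clause has to become a single positive existential term before
  comprehension can be applied to it.\<close>

lemma ex_conjunction_term:
  assumes "\<forall>M \<in> set Ms. has_type \<Delta> Sig M Omicron \<and> pos_existential M"
  shows "\<exists>N. has_type \<Delta> Sig N Omicron \<and> pos_existential N \<and>
    (\<forall>\<alpha>. valuation \<Delta> H \<alpha> \<longrightarrow>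
      (den \<Delta> Sig H B N \<alpha> = tru \<longleftrightarrow> (\<forall>M \<in> set Ms. den \<Delta> Sig H B M \<alpha> = tru)))"
  using assms
proof (induction Ms)
  case Nil
  have "infinite {y. \<Delta> y = Omicron}"
    using env by (simp add: type_env_def argument_type_def)
  then obtain y where y: "\<Delta> y = Omicron"
    using not_finite_existsD by auto
  \<comment> \<open>There is no constant for truth; \<open>\<exists>y. y\<close> plays its role.\<close>
  let ?N = "App (Ex Omicron) (Lam y (Var y))"
  have L: "has_type \<Delta> Sig (Lam y (Var y)) (Arrow Omicron Omicron)"
    using has_type.Lam[OF has_type.Var, of \<Delta> y Sig y] y by simp
  then have "has_type \<Delta> Sig ?N Omicron"
    by (auto intro!: has_type.App[OF has_type.Ex] simp: argument_type_def)
  moreover have "den \<Delta> Sig H B ?N \<alpha> = tru" if \<alpha>: "valuation \<Delta> H \<alpha>" for \<alpha>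
  proof -
    have "den \<Delta> Sig H B (Lam y (Var y)) \<alpha> \<in> elts (H (Arrow Omicron Omicron))"
      using frame_den_in[OF env fr sig st L _ \<alpha>] by simp
    moreover have "den \<Delta> Sig H B (Lam y (Var y)) \<alpha> \<bullet> tru = tru" "tru \<in> elts (H Omicron)"
      using frame_vapp_den_Lam[OF env fr sig st \<alpha> has_type.Var, of y tru y] y frame_Omicron[OF fr]
      by (simp_all del: den.simps(8))
    ultimately show ?thesis
      by (auto simp: ex_fun_apply simp del: den.simps(8))
  qed
  ultimately show ?case
    by (intro exI[of _ ?N]) (simp del: den.simps)
next
  case (Cons M Ms)
  then obtain N where N: "has_type \<Delta> Sig N Omicron" "pos_existential N"
    "\<And>\<alpha>. valuation \<Delta> H \<alpha> \<Longrightarrow> den \<Delta> Sig H B N \<alpha> = tru \<longleftrightarrow> (\<forall>M \<in> set Ms. den \<Delta> Sig H B M \<alpha> = tru)"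
    by auto
  have M: "has_type \<Delta> Sig M Omicron" "pos_existential M"
    using Cons.prems by simp_all
  have "has_type \<Delta> Sig (App (App Conj M) N) Omicron"
    using M N by (blast intro: has_type.intros)
  moreover have "den \<Delta> Sig H B (App (App Conj M) N) \<alpha> = tru \<longleftrightarrow>
      (\<forall>M \<in> set (M # Ms). den \<Delta> Sig H B M \<alpha> = tru)" if \<alpha>: "valuation \<Delta> H \<alpha>" for \<alpha>
    using frame_den_in[OF env fr sig st M \<alpha>] frame_den_in[OF env fr sig st N(1,2) \<alpha>]
      frame_Omicron[OF fr] N(3)[OF \<alpha>] by (simp add: min_fun_apply)
  ultimately show ?case
    using M N by (intro exI[of _ "App (App Conj M) N"]) simp
qed

end

section \<open>Transfer of satisfiability\<close>

lemma relational_extension_signature: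
  assumes "fo_signature Sig" "relational_extension Sig Sig'"
  shows "signature Sig'"
  unfolding signature_def
proof (intro allI impI)
  fix c \<sigma> assume "Sig' c = Some \<sigma>"
  then show "is_type \<sigma>"
    using assms unfolding fo_signature_def relational_extension_def is_type_def
    by (metis map_le_def)
qed

lemma models_goal_clause:
  "models \<Delta> Sig' H B (map Neg Ms) \<longleftrightarrow>
    (\<forall>\<alpha>. valuation \<Delta> H \<alpha> \<longrightarrow> (\<exists>M \<in> set Ms. den \<Delta> Sig' H B M \<alpha> = fls))"
  by (simp add: models_def)

text \<open>Completeness is asked of the target frame, where the suprema are formed. That both
  frames expand the same structure makes the individuals agree.\<close>

theorem satisfiable_in_transfer:
  fixes H H' :: "ty \<Rightarrow> 'u::zermelo"
  assumes env: "type_env \<Delta>" and fo: "fo_signature Sig" and ext: "relational_extension Sig Sig'"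
    and \<Gamma>: "\<forall>C \<in> \<Gamma>. hochc \<Delta> Sig Sig' C"
    and fr: "frame \<Delta> H" "expands Sig D A H"
    and cfr: "complete_frame \<Delta> H'" "expands Sig D A H'"
    and sat: "satisfiable_in \<Delta> Sig Sig' A H \<Gamma>"
  shows "satisfiable_in \<Delta> Sig Sig' A H' \<Gamma>"
proof -
  note sig = relational_extension_signature[OF fo ext]
  have fr': "frame \<Delta> H'"
    using cfr(1) by (simp add: complete_frame_def)
  have iota: "H' Iota = H Iota"
    using fr(2) cfr(2) by (simp add: expands_def)
  obtain B where st: "struct Sig' H B" and BA: "\<And>c. c \<in> dom Sig \<Longrightarrow> B c = A c"
    and mod: "\<And>C. C \<in> \<Gamma> \<Longrightarrow> models \<Delta> Sig' H B C"
    using sat by (auto simp: satisfiable_in_def expansion_def)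
  \<comment> \<open>\<open>the\<close> is proper at the symbols declared in \<open>Sig'\<close>, the
    only ones whose interpretation matters.\<close>
  define below where "below c = {r \<in> elts (H' (the (Sig' c))). approx H' H (the (Sig' c)) r (B c)}" for c
  define B' where "B' c = (if c \<in> dom Sig then A c else pointwise_lub H' (the (Sig' c)) (below c))" for c
  have rel: "relational \<rho>" if "Sig' c = Some \<rho>" "c \<notin> dom Sig" for c \<rho>
    using ext that by (auto simp: relational_extension_def)
  have old: "Sig c = Some \<sigma>" if "Sig' c = Some \<sigma>" "c \<in> dom Sig" for c \<sigma>
    using ext that by (auto simp: relational_extension_def map_le_def)
  have st': "struct Sig' H' B'"
    unfolding struct_def
  proof (intro allI impI)
    fix c \<sigma> assume c: "Sig' c = Some \<sigma>"
    show "B' c \<in> elts (H' \<sigma>)"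
    proof (cases "c \<in> dom Sig")
      case True
      then show ?thesis
        using cfr(2) old[OF c] by (simp add: B'_def expands_def)
    next
      case False
      then show ?thesis
        using cfr(1) rel[OF c] c by (auto simp: B'_def below_def complete_frame_def)
    qed
  qed
  have approx: "approx H' H \<sigma> (B' c) (B c)" if c: "Sig' c = Some \<sigma>" for c \<sigma>
  proof (cases "c \<in> dom Sig")
    case True
    then show ?thesis
      using fo old[OF c] BA by (simp add: B'_def approx_first_order_refl fo_signature_def)
  next
    case False
    have "approx H' H \<sigma> (pointwise_lub H' \<sigma> (below c)) (B c)"
      by (rule approx_pointwise_lub[OF cfr(1) rel[OF c False]]) (auto simp: below_def c)
    then show ?thesis
      using False c by (simp add: B'_def)
  qed
  have atom_approx: "den \<Delta> Sig' H B M \<alpha> = tru"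
    if "atom \<Delta> Sig' M" "den \<Delta> Sig' H' B' M \<alpha>' = tru" "valuation \<Delta> H' \<alpha>'" "valuation \<Delta> H \<alpha>"
      "\<And>x. approx H' H (\<Delta> x) (\<alpha>' x) (\<alpha> x)" for M \<alpha> \<alpha>'
    using approx_den[OF env sig fr(1) fr' st st' approx, of M Omicron \<alpha>' \<alpha>] that
    by (simp add: atom_def)
  \<comment> \<open>\<open>Neg\<close> tests for \<open>fls\<close>, whereas the relation transports
    \<open>tru\<close>; two-valuedness of atoms links the two.\<close>
  have atom_bool: "den \<Delta> Sig' H' B' M \<alpha> = fls \<or> den \<Delta> Sig' H' B' M \<alpha> = tru"
    if "atom \<Delta> Sig' M" "valuation \<Delta> H' \<alpha>" for M \<alpha>
    using that frame_den_in[OF env fr' sig st', of M Omicron \<alpha>] frame_Omicron[OF fr']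
    by (auto simp: atom_def no_logical_symbol_pos_existential)
  have "models \<Delta> Sig' H' B' C" if C: "C \<in> \<Gamma>" for C
  proof -
    from \<Gamma> C consider "goal_clause \<Delta> Sig' C" | "definite_clause \<Delta> Sig Sig' C"
      unfolding hochc_def by blast
    then show ?thesis
    proof cases
      case 1
      then obtain As where As: "\<And>M. M \<in> set As \<Longrightarrow> atom \<Delta> Sig' M" and C_eq: "C = map Neg As"
        unfolding goal_clause_def by blast
      show ?thesis
        unfolding C_eq models_goal_clause
      proof (intro allI impI)
        fix \<alpha>' assume \<alpha>': "valuation \<Delta> H' \<alpha>'"
        \<comment> \<open>Goal clauses are antitone in the relational variables, so the latter may be
          interpreted by the greatest elements of \<open>H\<close>.\<close>
        obtain \<alpha> where \<alpha>: "valuation \<Delta> H \<alpha>" "\<And>x. approx H' H (\<Delta> x) (\<alpha>' x) (\<alpha> x)"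
          using ex_approx_valuation[OF env fr(1) iota \<alpha>'] by blast
        obtain M where "M \<in> set As" "den \<Delta> Sig' H B M \<alpha> = fls"
          using mod[OF C] \<alpha>(1) unfolding C_eq models_goal_clause by blast
        then show "\<exists>M \<in> set As. den \<Delta> Sig' H' B' M \<alpha>' = fls"
          using atom_approx[OF As _ \<alpha>' \<alpha>] atom_bool[OF As \<alpha>'] by (metis tru_neq_fls(1))
      qed
    next
      case 2
      then obtain As R xs where As: "\<And>M. M \<in> set As \<Longrightarrow> atom \<Delta> Sig' M"
        and R: "R \<notin> dom Sig" and xs: "distinct xs"
        and ty: "has_type \<Delta> Sig' (foldl App (Con R) (map Var xs)) Omicron"
        and C_eq: "C = map Neg As @ [foldl App (Con R) (map Var xs)]"
        unfolding definite_clause_def goal_clause_def by blast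
      let ?\<rho> = "arrows \<Delta> xs Omicron"
      have Sig_R: "Sig' R = Some ?\<rho>"
        using has_type_foldl_App[OF ty] by (auto elim: has_type.cases)
      have clause: "(\<exists>M \<in> set As. den \<Delta> Sig' H B M \<alpha> = fls) \<or> foldl (\<bullet>) (B R) (map \<alpha> xs) = tru"
        if "valuation \<Delta> H \<alpha>" for \<alpha>
        using mod[OF C] that unfolding C_eq models_def by (auto simp: den_foldl_App)
      have "\<forall>M \<in> set As. has_type \<Delta> Sig' M Omicron \<and> pos_existential M"
        using As by (simp add: atom_def no_logical_symbol_pos_existential)
      from ex_conjunction_term[OF env fr' sig st' this]
      obtain N where N: "has_type \<Delta> Sig' N Omicron" "pos_existential N"
        and den_N: "\<And>\<alpha>'. valuation \<Delta> H' \<alpha>' \<Longrightarrow>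
          den \<Delta> Sig' H' B' N \<alpha>' = tru \<longleftrightarrow> (\<forall>M \<in> set As. den \<Delta> Sig' H' B' M \<alpha>' = tru)"
        by blast
      show ?thesis
        unfolding models_def
      proof (intro allI impI)
        fix \<alpha>' assume \<alpha>': "valuation \<Delta> H' \<alpha>'"
        have "foldl (\<bullet>) (B' R) (map \<alpha>' xs) = tru"
          if true: "\<forall>M \<in> set As. den \<Delta> Sig' H' B' M \<alpha>' = tru"
        proof -
          \<comment> \<open>The body of the clause, abstracted over \<open>xs\<close>, is an element of \<open>H'\<close> by
            comprehension, and it is one of the relations of which \<open>B' R\<close> is the supremum.\<close>
          define r where "r = den \<Delta> Sig' H' B' (foldr Lam xs N) \<alpha>'"
          have "r \<in> elts (H' ?\<rho>)"
            unfolding r_def using has_type_foldr_Lam[OF env N(1)] N(2) \<alpha>'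
            by (intro frame_den_in[OF env fr' sig st']) (auto simp: pos_existential_foldr_Lam)
          moreover have "approx H' H ?\<rho> r (B R)"
            unfolding r_def
          proof (rule approx_den_foldr_Lam[OF env fr' sig st' N fr(1) iota xs \<alpha>'])
            fix \<beta> \<beta>'
            assume \<beta>: "valuation \<Delta> H' \<beta>" "valuation \<Delta> H \<beta>'" "\<And>x. approx H' H (\<Delta> x) (\<beta> x) (\<beta>' x)"
              "den \<Delta> Sig' H' B' N \<beta> = tru"
            \<comment> \<open>The atoms of the body pass from \<open>B'\<close> to \<open>B\<close>
              at related valuations. So every negated disjunct of the clause fails in
              \<open>B\<close>, and the head must hold.\<close>
            then have "den \<Delta> Sig' H B M \<beta>' = tru" if "M \<in> set As" for M
              using den_N[OF \<beta>(1)] atom_approx[OF As _ \<beta>(1-3)] that by blast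
            then show "foldl (\<bullet>) (B R) (map \<beta>' xs) = tru"
              using clause[OF \<beta>(2)] by force
          qed
          ultimately have "r \<in> below R"
            by (simp add: below_def Sig_R)
          moreover have "foldl (\<bullet>) r (map \<alpha>' xs) = tru"
            unfolding r_def foldl_vapp_den_foldr_Lam[OF env fr' sig st' N \<alpha>'] den_N[OF \<alpha>']
            by (rule true)
          ultimately show ?thesis
            using pointwise_lub_upper[OF cfr(1) \<alpha>'] rel[OF Sig_R R] R
            by (auto simp: B'_def below_def Sig_R)
        qed
        then show "\<exists>F \<in> set C. den \<Delta> Sig' H' B' F \<alpha>' = tru"
          using atom_bool[OF As \<alpha>'] by (auto simp: C_eq den_foldl_App)
      qed
    qed
  qed
  moreover have "expansion Sig Sig' A H' B'"
    using st' by (simp add: expansion_def B'_def)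
  ultimately show ?thesis
    unfolding satisfiable_in_def by blast
qed

section \<open>Frames of functions preserving directed suprema\<close>

text \<open>
  Taking \<open>K\<close> to be constantly false, finiteness, or constantly true yields the standard, the
  monotone and the continuous frame.
\<close>

primrec lub_frame :: "('u::zermelo set \<Rightarrow> bool) \<Rightarrow> 'u \<Rightarrow> ty \<Rightarrow> 'u" where
  "lub_frame K D Iota = D"
| "lub_frame K D Omicron = bools"
| "lub_frame K D (Arrow \<tau> \<sigma>) =
     vset {f \<in> elts (vfun (lub_frame K D \<tau>) (lub_frame K D \<sigma>)).
       \<forall>X s. K X \<longrightarrow> X \<subseteq> elts (lub_frame K D \<tau>) \<longrightarrow> directed (le \<tau>) X \<longrightarrow>
         is_lub (le \<tau>) (elts (lub_frame K D \<tau>)) X s \<longrightarrow>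
         is_lub (le \<sigma>) (elts (lub_frame K D \<sigma>)) ((\<bullet>) f ` X) (f \<bullet> s)}"

declare le.simps(2,3) [simp del] lub_frame.simps(3) [simp del]

section \<open>The pointwise order and its suprema\<close>

text \<open>\<open>K\<close> selects the directed sets whose suprema are to be preserved. By
  \<open>K_finite\<close> it is empty or contains all finite sets, and in the latter case functions
  are monotone; \<open>K_image\<close> is used to compose functions.\<close>

locale set_class =
  fixes K :: "'u::zermelo set \<Rightarrow> bool" and D :: 'u
  assumes D_nonempty: "elts D \<noteq> {}"
    and K_finite: "K X \<Longrightarrow> finite Y \<Longrightarrow> K Y"
    and K_image: "K X \<Longrightarrow> K (f ` X)"
begin

abbreviation "F \<equiv> lub_frame K D"
abbreviation "P \<sigma> \<equiv> elts (F \<sigma>)"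
abbreviation "lub \<sigma> \<equiv> is_lub (le \<sigma>) (P \<sigma>)"

definition admissible :: "ty \<Rightarrow> 'u set \<Rightarrow> 'u \<Rightarrow> bool" where
  "admissible \<sigma> X s \<longleftrightarrow> K X \<and> X \<subseteq> P \<sigma> \<and> directed (le \<sigma>) X \<and> lub \<sigma> X s"

lemma mem_Arrow:
  "f \<in> P (Arrow \<tau> \<sigma>) \<longleftrightarrow> f \<in> elts (vfun (F \<tau>) (F \<sigma>)) \<and>
    (\<forall>X s. admissible \<tau> X s \<longrightarrow> lub \<sigma> ((\<bullet>) f ` X) (f \<bullet> s))"
  unfolding lub_frame.simps(3) admissible_def
  by (subst elts_vset[where a = "vfun (F \<tau>) (F \<sigma>)"]) auto

lemma admissibleD:
  assumes "admissible \<sigma> X s"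
  shows "K X" "X \<subseteq> P \<sigma>" "X \<noteq> {}" "s \<in> P \<sigma>" "\<And>x. x \<in> X \<Longrightarrow> le \<sigma> x s"
    "\<And>u. u \<in> P \<sigma> \<Longrightarrow> (\<And>x. x \<in> X \<Longrightarrow> le \<sigma> x u) \<Longrightarrow> le \<sigma> s u"
    "\<And>x y. x \<in> X \<Longrightarrow> y \<in> X \<Longrightarrow> \<exists>z \<in> X. le \<sigma> x z \<and> le \<sigma> y z" "lub \<sigma> X s"
  using assms unfolding admissible_def directed_def is_lub_def by blast+

lemma in_vfun: "f \<in> P (Arrow \<tau> \<sigma>) \<Longrightarrow> f \<in> elts (vfun (F \<tau>) (F \<sigma>))"
  by (simp only: mem_Arrow)

lemma app_in: "f \<in> P (Arrow \<tau> \<sigma>) \<Longrightarrow> x \<in> P \<tau> \<Longrightarrow> f \<bullet> x \<in> P \<sigma>"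
  by (blast dest: in_vfun vapp_in)

lemma le_Arrow: "f \<in> P (Arrow \<tau> \<sigma>) \<Longrightarrow> le (Arrow \<tau> \<sigma>) f g \<longleftrightarrow> (\<forall>x \<in> P \<tau>. le \<sigma> (f \<bullet> x) (g \<bullet> x))"
  by (simp add: le.simps(3) vdom_vfun[OF in_vfun])

lemma le_refl: "a \<in> P \<sigma> \<Longrightarrow> le \<sigma> a a"
proof (induction \<sigma> arbitrary: a)
  case (Arrow \<tau> \<sigma>)
  then show ?case
    using app_in by (simp add: le_Arrow)
qed (auto simp: le.simps(2))

lemma le_trans:
  "a \<in> P \<sigma> \<Longrightarrow> b \<in> P \<sigma> \<Longrightarrow> c \<in> P \<sigma> \<Longrightarrow> le \<sigma> a b \<Longrightarrow> le \<sigma> b c \<Longrightarrow> le \<sigma> a c"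
proof (induction \<sigma> arbitrary: a b c)
  case (Arrow \<tau> \<sigma>)
  then show ?case
    using app_in by (simp add: le_Arrow) blast
qed (auto simp: le.simps(2))

lemma le_antisym: "a \<in> P \<sigma> \<Longrightarrow> b \<in> P \<sigma> \<Longrightarrow> le \<sigma> a b \<Longrightarrow> le \<sigma> b a \<Longrightarrow> a = b"
proof (induction \<sigma> arbitrary: a b)
  case (Arrow \<tau> \<sigma>)
  show ?case
  proof (rule vfun_ext[OF in_vfun in_vfun])
    fix x assume "x \<in> P \<tau>"
    then show "a \<bullet> x = b \<bullet> x"
      using Arrow.prems app_in by (intro Arrow.IH(2)) (auto simp: le_Arrow)
  qed (use Arrow.prems in auto)
qed (auto simp: le.simps(2))

lemma lub_unique: "lub \<sigma> X a \<Longrightarrow> lub \<sigma> X b \<Longrightarrow> a = b"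
  unfolding is_lub_def by (blast intro: le_antisym)

lemma lub_const: "c \<in> P \<sigma> \<Longrightarrow> X \<noteq> {} \<Longrightarrow> lub \<sigma> ((\<lambda>_. c) ` X) c"
  unfolding is_lub_def by (auto simp: le_refl)

lemma lub_const_admissible: "c \<in> P \<sigma> \<Longrightarrow> admissible \<tau> X s \<Longrightarrow> lub \<sigma> ((\<lambda>_. c) ` X) c"
  by (rule lub_const[OF _ admissibleD(3)])

lemma lub_Omicron: "X \<subseteq> elts bools \<Longrightarrow> lub Omicron X s \<longleftrightarrow> s = tv (tru \<in> X)"
  unfolding is_lub_def by (auto simp: tv_def le.simps(2))

lemmas lub_bools = lub_Omicron[unfolded lub_frame.simps(2)]

lemma vlam_in_Arrow:
  assumes "\<And>x. x \<in> P \<tau> \<Longrightarrow> f x \<in> P \<sigma>" "\<And>X s. admissible \<tau> X s \<Longrightarrow> lub \<sigma> (f ` X) (f s)"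
  shows "vlam (F \<tau>) f \<in> P (Arrow \<tau> \<sigma>)"
  unfolding mem_Arrow
proof (intro conjI allI impI)
  show "vlam (F \<tau>) f \<in> elts (vfun (F \<tau>) (F \<sigma>))"
    using assms(1) by (rule vlam_in_vfun)
  fix X s assume X: "admissible \<tau> X s"
  have app: "vlam (F \<tau>) f \<bullet> x = f x" if "x \<in> P \<tau>" for x
    using vapp_vlam[of "F \<tau>" f "F \<sigma>", OF assms(1) that] .
  then have "(\<bullet>) (vlam (F \<tau>) f) ` X = f ` X"
    using admissibleD(2)[OF X] by (intro image_cong) auto
  then show "lub \<sigma> ((\<bullet>) (vlam (F \<tau>) f) ` X) (vlam (F \<tau>) f \<bullet> s)"
    using assms(2)[OF X] app[OF admissibleD(4)[OF X]] by simp
qed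

lemma lub_Arrow_pointwiseI:
  assumes "X \<subseteq> P (Arrow \<tau> \<sigma>)" "f \<in> P (Arrow \<tau> \<sigma>)"
    and "\<And>x. x \<in> P \<tau> \<Longrightarrow> lub \<sigma> ((\<lambda>g. g \<bullet> x) ` X) (f \<bullet> x)"
  shows "lub (Arrow \<tau> \<sigma>) X f"
  using assms app_in unfolding is_lub_def
  by (auto simp: le_Arrow subset_iff)

text \<open>Suprema commute with suprema, so a pointwise supremum of functions that preserve
  admissible suprema preserves them too and stays in the frame.\<close>

lemma pointwise_lub_lub:
  "relational \<rho> \<Longrightarrow> R \<subseteq> P \<rho> \<Longrightarrow> lub \<rho> R (pointwise_lub F \<rho> R)"
proof (induction \<rho> arbitrary: R)
  case Omicron
  then show ?case
    by (simp add: lub_bools del: elts_bools)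
next
  case (Arrow \<tau> \<rho>)
  have IH: "lub \<rho> ((\<lambda>f. f \<bullet> s) ` R) (pointwise_lub F \<rho> ((\<lambda>f. f \<bullet> s) ` R))" if "s \<in> P \<tau>" for s
    using Arrow.prems app_in that by (intro Arrow.IH) auto
  then have in_P: "pointwise_lub F \<rho> ((\<lambda>f. f \<bullet> s) ` R) \<in> P \<rho>" if "s \<in> P \<tau>" for s
    using that unfolding is_lub_def by blast
  have "pointwise_lub F (Arrow \<tau> \<rho>) R \<in> P (Arrow \<tau> \<rho>)"
    unfolding pointwise_lub.simps
  proof (rule vlam_in_Arrow[OF in_P])
    fix X s assume X: "admissible \<tau> X s"
    have f: "lub \<rho> ((\<bullet>) f ` X) (f \<bullet> s)" if "f \<in> R" for f
      using X Arrow.prems(2) that mem_Arrow by blast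
    note sX = admissibleD(2,4)[OF X]
    have app: "f \<bullet> x \<in> P \<rho>" if "f \<in> R" "x \<in> P \<tau>" for f x
      using that Arrow.prems(2) app_in by blast
    show "lub \<rho> ((\<lambda>s. pointwise_lub F \<rho> ((\<lambda>f. f \<bullet> s) ` R)) ` X) (pointwise_lub F \<rho> ((\<lambda>f. f \<bullet> s) ` R))"
      unfolding is_lub_def
    proof (intro conjI ballI impI)
      show "pointwise_lub F \<rho> ((\<lambda>f. f \<bullet> s) ` R) \<in> P \<rho>"
        using in_P sX by blast
    next
      fix y assume "y \<in> (\<lambda>s. pointwise_lub F \<rho> ((\<lambda>f. f \<bullet> s) ` R)) ` X"
      then obtain x where x: "x \<in> X" "y = pointwise_lub F \<rho> ((\<lambda>f. f \<bullet> x) ` R)"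
        by blast
      have "le \<rho> (f \<bullet> x) (pointwise_lub F \<rho> ((\<lambda>f. f \<bullet> s) ` R))" if "f \<in> R" for f
      proof (rule le_trans)
        show "le \<rho> (f \<bullet> x) (f \<bullet> s)"
          using f[OF that] x by (auto simp: is_lub_def)
        show "le \<rho> (f \<bullet> s) (pointwise_lub F \<rho> ((\<lambda>f. f \<bullet> s) ` R))"
          using IH[OF sX(2)] that by (auto simp: is_lub_def)
      qed (use that sX x app in_P in auto)
      then show "le \<rho> y (pointwise_lub F \<rho> ((\<lambda>f. f \<bullet> s) ` R))"
        using IH[of x] in_P[OF sX(2)] x sX by (auto simp: is_lub_def)
    next
      fix u assume u: "u \<in> P \<rho>"
        "\<forall>x \<in> (\<lambda>s. pointwise_lub F \<rho> ((\<lambda>f. f \<bullet> s) ` R)) ` X. le \<rho> x u"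
      \<comment> \<open>The interchange: \<open>u\<close> bounds every \<open>f \<bullet> x\<close>,
        hence every \<open>f \<bullet> s\<close> by preservation, hence their supremum.\<close>
      have "le \<rho> (f \<bullet> s) u" if "f \<in> R" for f
      proof -
        have "le \<rho> (f \<bullet> x) u" if "x \<in> X" for x
        proof (rule le_trans)
          show "le \<rho> (f \<bullet> x) (pointwise_lub F \<rho> ((\<lambda>f. f \<bullet> x) ` R))"
            using IH[of x] that \<open>f \<in> R\<close> sX by (auto simp: is_lub_def)
        qed (use that \<open>f \<in> R\<close> sX app in_P u in auto)
        then show ?thesis
          using f[OF that] u(1) by (auto simp: is_lub_def)
      qed
      then show "le \<rho> (pointwise_lub F \<rho> ((\<lambda>f. f \<bullet> s) ` R)) u"
        using IH[OF sX(2)] u(1) by (auto simp: is_lub_def)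
    qed
  qed
  moreover have "pointwise_lub F (Arrow \<tau> \<rho>) R \<bullet> x = pointwise_lub F \<rho> ((\<lambda>f. f \<bullet> x) ` R)"
    if "x \<in> P \<tau>" for x
    using that in_P by (simp add: vapp_vlam[where B = "F \<rho>"])
  ultimately show ?case
    using IH Arrow.prems(2) by (intro lub_Arrow_pointwiseI) auto
qed simp

text \<open>Such a type ends in \<open>Iota\<close>, where the order is equality.\<close>

lemma first_order_flat:
  "first_order \<sigma> \<Longrightarrow> \<not> relational \<sigma> \<Longrightarrow> a \<in> P \<sigma> \<Longrightarrow> b \<in> P \<sigma> \<Longrightarrow> le \<sigma> a b \<Longrightarrow> a = b"
proof (induction \<sigma> arbitrary: a b)
  case (Arrow \<tau> \<sigma>)
  show ?case
  proof (rule vfun_ext[OF in_vfun in_vfun])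
    fix x assume "x \<in> P \<tau>"
    then show "a \<bullet> x = b \<bullet> x"
      using Arrow.prems app_in
      by (intro Arrow.IH(2)) (auto simp: le_Arrow)
  qed (use Arrow.prems in auto)
qed auto

text \<open>At relational types the pointwise supremum exists, and suprema are unique. At the
  remaining types the order is discrete, so a nonempty bounded set is a singleton.\<close>

lemma lub_Arrow_pointwiseD:
  assumes "is_type (Arrow \<tau> \<sigma>)" "X \<subseteq> P (Arrow \<tau> \<sigma>)" "X \<noteq> {}" "lub (Arrow \<tau> \<sigma>) X f" "x \<in> P \<tau>"
  shows "lub \<sigma> ((\<lambda>g. g \<bullet> x) ` X) (f \<bullet> x)"
proof (cases "relational (Arrow \<tau> \<sigma>)")
  case True
  then have \<sigma>: "relational \<sigma>"
    by simp
  have lub: "lub \<sigma> ((\<lambda>g. g \<bullet> y) ` X) (pointwise_lub F \<sigma> ((\<lambda>g. g \<bullet> y) ` X))" if "y \<in> P \<tau>" for y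
    using assms(2) that app_in by (intro pointwise_lub_lub[OF \<sigma>]) auto
  then have "pointwise_lub F \<sigma> ((\<lambda>g. g \<bullet> y) ` X) \<in> P \<sigma>" if "y \<in> P \<tau>" for y
    using that unfolding is_lub_def by blast
  then have "pointwise_lub F (Arrow \<tau> \<sigma>) X \<bullet> x = pointwise_lub F \<sigma> ((\<lambda>g. g \<bullet> x) ` X)"
    using assms(5) by (simp add: vapp_vlam[where B = "F \<sigma>"])
  moreover have "f = pointwise_lub F (Arrow \<tau> \<sigma>) X"
    using lub_unique[OF assms(4) pointwise_lub_lub[OF True assms(2)]] .
  ultimately show ?thesis
    using lub[OF assms(5)] by simp
next
  case False
  then have fo: "first_order (Arrow \<tau> \<sigma>)"
    using assms(1) unfolding is_type_def by blast
  have "g = f" if "g \<in> X" for g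
    using first_order_flat[OF fo False, of g f] assms(2,4) that unfolding is_lub_def by blast
  then have "X = {f}"
    using assms(3) by blast
  moreover have "f \<bullet> x \<in> P \<sigma>"
    using assms(4,5) app_in unfolding is_lub_def by blast
  ultimately show ?thesis
    by (simp add: is_lub_def le_refl)
qed

text \<open>Preserving the supremum of a two-element chain is monotonicity. The premise
  \<open>K X\<close> says that \<open>K\<close> is inhabited, which separates this case from the
  standard frame.\<close>

lemma admissible_pair:
  assumes "K X" "a \<in> P \<sigma>" "b \<in> P \<sigma>" "le \<sigma> a b"
  shows "admissible \<sigma> {a, b} b"
  using assms K_finite[of X "{a, b}"] unfolding admissible_def directed_def is_lub_def
  by (auto simp: le_refl)

lemma lub_pairD: "lub \<sigma> (f ` {a, b}) (f b) \<Longrightarrow> le \<sigma> (f a) (f b)"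
  by (simp add: is_lub_def)

lemma app_mono:
  assumes "K X" "f \<in> P (Arrow \<tau> \<sigma>)" "a \<in> P \<tau>" "b \<in> P \<tau>" "le \<tau> a b"
  shows "le \<sigma> (f \<bullet> a) (f \<bullet> b)"
  using assms(2) admissible_pair[OF assms(1,3-5)] unfolding mem_Arrow by (blast intro: lub_pairD)

text \<open>By directedness, the supremum over the diagonal is the iterated supremum.\<close>

lemma lub_app:
  assumes ty: "is_type (Arrow \<tau> \<sigma>)"
    and X: "admissible \<upsilon> X s"
    and f: "\<And>Y t. admissible \<upsilon> Y t \<Longrightarrow> lub (Arrow \<tau> \<sigma>) (f ` Y) (f t)"
    and g: "\<And>Y t. admissible \<upsilon> Y t \<Longrightarrow> lub \<tau> (g ` Y) (g t)"
    and f_in: "\<And>a. a \<in> P \<upsilon> \<Longrightarrow> f a \<in> P (Arrow \<tau> \<sigma>)" and g_in: "\<And>a. a \<in> P \<upsilon> \<Longrightarrow> g a \<in> P \<tau>"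
  shows "lub \<sigma> ((\<lambda>a. f a \<bullet> g a) ` X) (f s \<bullet> g s)"
proof -
  \<comment> \<open>That \<open>X\<close> itself is in \<open>K\<close> makes all the maps involved
    monotone.\<close>
  note K = admissibleD(1)[OF X]
  have XP: "a \<in> P \<upsilon>" if "a \<in> X" for a
    using admissibleD(2)[OF X] that by blast
  note sP = admissibleD(4)[OF X]
  have app: "f a \<bullet> g b \<in> P \<sigma>" if "a \<in> P \<upsilon>" "b \<in> P \<upsilon>" for a b
    using app_in[OF f_in g_in] that by blast
  have f_mono: "le \<sigma> (f a \<bullet> n) (f b \<bullet> n)" if "a \<in> P \<upsilon>" "b \<in> P \<upsilon>" "le \<upsilon> a b" "n \<in> P \<tau>" for a b n
    using lub_pairD[OF f[OF admissible_pair[OF K that(1-3)]]] that f_in by (simp add: le_Arrow)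
  have g_mono: "le \<tau> (g a) (g b)" if "a \<in> P \<upsilon>" "b \<in> P \<upsilon>" "le \<upsilon> a b" for a b
    using lub_pairD[OF g[OF admissible_pair[OF K that]]] .
  have fg_mono: "le \<sigma> (f c \<bullet> g a) (f c \<bullet> g b)" if "a \<in> P \<upsilon>" "b \<in> P \<upsilon>" "le \<upsilon> a b" "c \<in> P \<upsilon>" for a b c
    using app_mono[OF K f_in g_in g_in g_mono] that by blast
  \<comment> \<open>The image under \<open>g\<close> is again directed and in \<open>K\<close>, so
    the single function \<open>f s\<close> preserves its supremum.\<close>
  have "admissible \<tau> (g ` X) (g s)"
    unfolding admissible_def
  proof (intro conjI)
    show "directed (le \<tau>) (g ` X)"
      using admissibleD(3,7)[OF X] g_mono XP unfolding directed_def by (auto; meson)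
  qed (use K K_image g[OF X] g_in XP in auto)
  then have lub_g: "lub \<sigma> ((\<bullet>) (f s) ` g ` X) (f s \<bullet> g s)"
    using f_in[OF sP] unfolding mem_Arrow by blast
  have lub_f: "lub \<sigma> ((\<lambda>h. h \<bullet> n) ` f ` X) (f s \<bullet> n)" if "n \<in> P \<tau>" for n
    using f[OF X] f_in XP admissibleD(3)[OF X] that by (intro lub_Arrow_pointwiseD[OF ty]) auto
  show ?thesis
    unfolding is_lub_def
  proof (intro conjI ballI impI)
    show "f s \<bullet> g s \<in> P \<sigma>"
      using app sP by blast
  next
    fix y assume "y \<in> (\<lambda>a. f a \<bullet> g a) ` X"
    then obtain a where a: "a \<in> X" "y = f a \<bullet> g a"
      by blast
    have "le \<upsilon> a s"
      using admissibleD(5)[OF X a(1)] .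
    then have "le \<sigma> (f a \<bullet> g a) (f s \<bullet> g a)" "le \<sigma> (f s \<bullet> g a) (f s \<bullet> g s)"
      using f_mono fg_mono XP[OF a(1)] sP g_in by blast+
    then show "le \<sigma> y (f s \<bullet> g s)"
      unfolding a(2) using XP[OF a(1)] sP by (blast intro: le_trans app)
  next
    fix u assume u: "u \<in> P \<sigma>" "\<forall>x \<in> (\<lambda>a. f a \<bullet> g a) ` X. le \<sigma> x u"
    have "le \<sigma> (f s \<bullet> g a) u" if a: "a \<in> X" for a
    proof -
      have "le \<sigma> (f b \<bullet> g a) u" if b: "b \<in> X" for b
      proof -
        \<comment> \<open>Moving both \<open>a\<close> and \<open>b\<close> up to \<open>c\<close>
          puts the off-diagonal value below a diagonal one.\<close>
        obtain c where c: "c \<in> X" "le \<upsilon> a c" "le \<upsilon> b c"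
          using admissibleD(7)[OF X a b] by blast
        note abc = XP[OF a] XP[OF b] XP[OF c(1)]
        have "le \<sigma> (f b \<bullet> g a) (f c \<bullet> g a)" "le \<sigma> (f c \<bullet> g a) (f c \<bullet> g c)" "le \<sigma> (f c \<bullet> g c) u"
          using abc c f_mono fg_mono g_in u(2) by blast+
        then show ?thesis
          using abc u(1) by (blast intro: le_trans app)
      qed
      then show ?thesis
        using lub_f[OF g_in[OF XP[OF a]]] u(1) by (auto simp: is_lub_def)
    qed
    then show "le \<sigma> (f s \<bullet> g s) u"
      using lub_g u(1) by (auto simp: is_lub_def)
  qed
qed

section \<open>Nonemptiness and logical constants in the frame\<close>

lemma nonempty: "P \<sigma> \<noteq> {}"
proof (induction \<sigma>)
  case (Arrow \<tau> \<sigma>)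
  then obtain c where c: "c \<in> P \<sigma>"
    by blast
  have "vlam (F \<tau>) (\<lambda>_. c) \<in> P (Arrow \<tau> \<sigma>)"
    using c by (intro vlam_in_Arrow lub_const) (auto dest: admissibleD(3))
  then show ?case
    by blast
qed (use D_nonempty in auto)

lemma admissible_Omicron: "admissible Omicron X s \<Longrightarrow> X \<subseteq> elts bools \<and> s = tv (tru \<in> X)"
  using admissibleD(2,8)[of Omicron X s] lub_Omicron[of X s] by (simp del: elts_bools)

lemma tru_in_image:
  assumes "\<And>b. b \<in> X \<Longrightarrow> f b = tv (Q b)"
  shows "tru \<in> f ` X \<longleftrightarrow> (\<exists>b \<in> X. Q b)"
  unfolding image_iff using assms tv_eq_tru by (metis (full_types))

text \<open>\<open>True \<in> Q\<close> is the supremum of a set \<open>Q\<close> of truth values,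
  so \<open>left\<close> and \<open>right\<close> state preservation in each argument. Disjunction
  satisfies them for nonempty \<open>Q\<close>, and directed sets are nonempty.\<close>

lemma binary_bool_in:
  assumes op: "\<And>a b. a \<in> elts bools \<Longrightarrow> b \<in> elts bools \<Longrightarrow> f a b = tv (g (a = tru) (b = tru))"
    and left: "\<And>Q b. Q \<noteq> {} \<Longrightarrow> g (True \<in> Q) b \<longleftrightarrow> (\<exists>a \<in> Q. g a b)"
    and right: "\<And>Q a. Q \<noteq> {} \<Longrightarrow> g a (True \<in> Q) \<longleftrightarrow> (\<exists>b \<in> Q. g a b)"
  shows "vlam bools (\<lambda>a. vlam bools (f a)) \<in> P (Arrow Omicron (Arrow Omicron Omicron))"
proof -
  have in_bools: "f a b \<in> elts bools" if "a \<in> elts bools" "b \<in> elts bools" for a b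
    unfolding op[OF that] by (rule tv_in_bools)
  have inner: "vlam bools (f a) \<in> P (Arrow Omicron Omicron)" if a: "a \<in> elts bools" for a
  proof (subst lub_frame.simps(2)[symmetric, of K D], rule vlam_in_Arrow)
    fix X s assume X: "admissible Omicron X s"
    note Xs = admissible_Omicron[OF X]
    have "f a s = tv (g (a = tru) (True \<in> (\<lambda>b. b = tru) ` X))"
      using Xs by (subst op[OF a]) (auto simp: tv_cases intro!: arg_cong[where f = tv])
    also have "\<dots> = tv (\<exists>b \<in> X. g (a = tru) (b = tru))"
      using right[of "(\<lambda>b. b = tru) ` X" "a = tru"] admissibleD(3)[OF X] by simp
    also have "\<dots> = tv (tru \<in> f a ` X)"
      using Xs op[OF a] by (subst tru_in_image[where Q = "\<lambda>b. g (a = tru) (b = tru)"]) auto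
    finally have eq: "f a s = tv (tru \<in> f a ` X)" .
    have "f a ` X \<subseteq> elts bools"
      using Xs in_bools[OF a] by blast
    from lub_Omicron[OF this] eq show "lub Omicron (f a ` X) (f a s)"
      by blast
  qed (use in_bools a in auto)
  have "vlam (F Omicron) (\<lambda>a. vlam bools (f a)) \<in> P (Arrow Omicron (Arrow Omicron Omicron))"
  proof (rule vlam_in_Arrow)
    fix X s assume X: "admissible Omicron X s"
    note Xs = admissible_Omicron[OF X]
    have s: "s \<in> elts bools"
      using Xs tv_in_bools by blast
    show "lub (Arrow Omicron Omicron) ((\<lambda>a. vlam bools (f a)) ` X) (vlam bools (f s))"
    proof (rule lub_Arrow_pointwiseI)
      fix b assume "b \<in> P Omicron"
      then have b: "b \<in> elts bools"
        by simp
      have app: "vlam bools (f a) \<bullet> b = f a b" if "a \<in> elts bools" for a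
        using in_bools that b by (intro vapp_vlam)
      have "f s b = tv (g (True \<in> (\<lambda>a. a = tru) ` X) (b = tru))"
        using Xs by (subst op[OF s b]) (auto simp: tv_cases intro!: arg_cong[where f = tv])
      also have "\<dots> = tv (\<exists>a \<in> X. g (a = tru) (b = tru))"
        using left[of "(\<lambda>b. b = tru) ` X" "b = tru"] admissibleD(3)[OF X] by simp
      also have "\<dots> = tv (tru \<in> (\<lambda>a. f a b) ` X)"
        using Xs op[OF _ b] by (subst tru_in_image[where Q = "\<lambda>a. g (a = tru) (b = tru)"]) auto
      finally have eq: "f s b = tv (tru \<in> (\<lambda>a. f a b) ` X)" .
      have "(\<lambda>a. f a b) ` X \<subseteq> elts bools"
        using Xs in_bools[OF _ b] by blast
      from lub_Omicron[OF this] eq have "lub Omicron ((\<lambda>a. f a b) ` X) (f s b)"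
        by blast
      moreover have "(\<lambda>h. h \<bullet> b) ` (\<lambda>a. vlam bools (f a)) ` X = (\<lambda>a. f a b) ` X"
        unfolding image_image using Xs app by (intro image_cong) auto
      ultimately show "lub Omicron ((\<lambda>h. h \<bullet> b) ` (\<lambda>a. vlam bools (f a)) ` X) (vlam bools (f s) \<bullet> b)"
        using app[OF s] by simp
    qed (use inner s Xs in auto)
  qed (use inner in simp)
  then show ?thesis
    by simp
qed

text \<open>Suprema of predicates are pointwise, so the claim is the exchange of two existential
  quantifiers.\<close>

lemma ex_fun_in:
  assumes "argument_type \<tau>"
  shows "ex_fun F \<tau> \<in> P (Arrow (Arrow \<tau> Omicron) Omicron)"
  unfolding ex_fun_def
proof (rule vlam_in_Arrow)
  fix X s assume X: "admissible (Arrow \<tau> Omicron) X s"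
  note XP = admissibleD(2)[OF X]
  have ty: "is_type (Arrow \<tau> Omicron)"
    using assms by (intro relational_is_type) (simp add: argument_type_def)
  have "s \<bullet> t = tru \<longleftrightarrow> (\<exists>r \<in> X. r \<bullet> t = tru)" if t: "t \<in> P \<tau>" for t
  proof -
    have "(\<lambda>g. g \<bullet> t) ` X \<subseteq> elts bools"
      using XP app_in[OF _ t, of _ Omicron] by auto
    moreover have "lub Omicron ((\<lambda>g. g \<bullet> t) ` X) (s \<bullet> t)"
      using lub_Arrow_pointwiseD[OF ty XP admissibleD(3,8)[OF X] t] .
    ultimately have "s \<bullet> t = tru \<longleftrightarrow> tru \<in> (\<lambda>g. g \<bullet> t) ` X"
      by (simp add: lub_bools del: elts_bools image_iff)
    then show ?thesis
      by (metis (no_types, lifting) image_iff)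
  qed
  then have eq: "(\<exists>t \<in> P \<tau>. s \<bullet> t = tru) \<longleftrightarrow> tru \<in> (\<lambda>r. tv (\<exists>t \<in> P \<tau>. r \<bullet> t = tru)) ` X"
    by (subst tru_in_image[OF refl]) blast
  have "(\<lambda>r. tv (\<exists>t \<in> P \<tau>. r \<bullet> t = tru)) ` X \<subseteq> elts bools"
    by (auto simp: tv_cases)
  note lub = lub_Omicron[OF this]
  show "lub Omicron ((\<lambda>r. tv (\<exists>t \<in> P \<tau>. r \<bullet> t = tru)) ` X) (tv (\<exists>t \<in> P \<tau>. s \<bullet> t = tru))"
    unfolding lub by (rule arg_cong[OF eq])
qed (auto simp: tv_cases)

lemma pre_frame: "pre_frame F"
  unfolding pre_frame_def
proof (intro conjI allI impI)
  show "min_fun \<in> P (Arrow Omicron (Arrow Omicron Omicron))"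
    unfolding min_fun_def by (rule binary_bool_in[where g = "(\<and>)"]) auto
  show "max_fun \<in> P (Arrow Omicron (Arrow Omicron Omicron))"
    unfolding max_fun_def by (rule binary_bool_in[where g = "(\<or>)"]) auto
  show "P (Arrow \<tau> \<sigma>) \<subseteq> elts (vfun (F \<tau>) (F \<sigma>))" for \<tau> \<sigma>
    using in_vfun by blast
qed (use nonempty ex_fun_in in auto)

section \<open>Comprehension for positive existential terms\<close>

text \<open>The three claims need one another: an abstraction lies in the frame because its body
  preserves suprema in the bound variable, and therefore the default branch of \<open>den\<close> is
  not taken. Preservation is stated for one variable at a time; \<open>lub_app\<close> handles a
  variable that occurs in both parts of an application.\<close>

lemma den_continuous:
  assumes env: "type_env \<Delta>" and sig: "signature Sig" and st: "struct Sig F B"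
  shows "has_type \<Delta> Sig M \<sigma> \<Longrightarrow> pos_existential M \<Longrightarrow> valuation \<Delta> F \<alpha> \<Longrightarrow>
    den \<Delta> Sig F B M \<alpha> \<in> P \<sigma> \<and>
    (\<forall>x X s. admissible (\<Delta> x) X s \<longrightarrow>
      lub \<sigma> ((\<lambda>a. den \<Delta> Sig F B M (\<alpha>(x := a))) ` X) (den \<Delta> Sig F B M (\<alpha>(x := s)))) \<and>
    (\<forall>x N. M = Lam x N \<longrightarrow>
      den \<Delta> Sig F B M \<alpha> = vlam (F (\<Delta> x)) (\<lambda>r. den \<Delta> Sig F B N (\<alpha>(x := r))))"
proof (induction arbitrary: \<alpha> rule: has_type.induct)
  case (Var y)
  then have "\<alpha> y \<in> P (\<Delta> y)"
    by (simp add: valuation_def)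
  moreover have "lub (\<Delta> y) ((\<lambda>a. (\<alpha>(x := a)) y) ` X) ((\<alpha>(x := s)) y)"
    if "admissible (\<Delta> x) X s" for x X s
    using calculation lub_const admissibleD(3,8)[OF that] by (cases "x = y") simp_all
  ultimately show ?case
    by simp
next
  case (Con c \<sigma>)
  then have "B c \<in> P \<sigma>"
    using st by (simp add: struct_def)
  then show ?case
    by (auto intro: lub_const_admissible)
next
  case (Neg M)
  then show ?case
    by simp
next
  case Conj
  then show ?case
    using pre_frame by (auto simp: pre_frame_def intro: lub_const_admissible)
next
  case Disj
  then show ?case
    using pre_frame by (auto simp: pre_frame_def intro: lub_const_admissible)
next
  case (Ex \<tau>)
  then show ?case
    using ex_fun_in by (auto intro: lub_const_admissible)
next
  case (App M \<sigma>\<^sub>1 \<sigma>\<^sub>2 N)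
  have pos: "pos_existential M" "pos_existential N"
    using App.prems by simp_all
  note M = App.IH(1)[OF pos(1)] and N = App.IH(2)[OF pos(2)]
  have "lub \<sigma>\<^sub>2 ((\<lambda>a. den \<Delta> Sig F B M (\<alpha>(x := a)) \<bullet> den \<Delta> Sig F B N (\<alpha>(x := a))) ` X)
      (den \<Delta> Sig F B M (\<alpha>(x := s)) \<bullet> den \<Delta> Sig F B N (\<alpha>(x := s)))"
    if X: "admissible (\<Delta> x) X s" for x X s
  proof (rule lub_app[OF has_type_is_type[OF env sig App.hyps(1)] X])
    fix Y t assume "admissible (\<Delta> x) Y t"
    then show "lub (Arrow \<sigma>\<^sub>1 \<sigma>\<^sub>2) ((\<lambda>a. den \<Delta> Sig F B M (\<alpha>(x := a))) ` Y) (den \<Delta> Sig F B M (\<alpha>(x := t)))"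
      and "lub \<sigma>\<^sub>1 ((\<lambda>a. den \<Delta> Sig F B N (\<alpha>(x := a))) ` Y) (den \<Delta> Sig F B N (\<alpha>(x := t)))"
      using M N App.prems(2) by blast+
  next
    fix a assume "a \<in> P (\<Delta> x)"
    then have "valuation \<Delta> F (\<alpha>(x := a))"
      using App.prems(2) by (rule valuation_upd[rotated])
    then show "den \<Delta> Sig F B M (\<alpha>(x := a)) \<in> P (Arrow \<sigma>\<^sub>1 \<sigma>\<^sub>2)" "den \<Delta> Sig F B N (\<alpha>(x := a)) \<in> P \<sigma>\<^sub>1"
      using M N by blast+
  qed
  moreover have "den \<Delta> Sig F B M \<alpha> \<bullet> den \<Delta> Sig F B N \<alpha> \<in> P \<sigma>\<^sub>2"
    using M N App.prems(2) app_in by blast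
  ultimately show ?case
    by (simp del: fun_upd_apply)
next
  case (Lam M \<rho> y)
  have pos: "pos_existential M"
    using Lam.prems by simp
  note M = Lam.IH[OF pos]
  let ?f = "\<lambda>\<alpha>. vlam (F (\<Delta> y)) (\<lambda>r. den \<Delta> Sig F B M (\<alpha>(y := r)))"
  have f_in: "?f \<alpha> \<in> P (Arrow (\<Delta> y) \<rho>)" if "valuation \<Delta> F \<alpha>" for \<alpha>
    using M that valuation_upd[OF that] by (intro vlam_in_Arrow) blast+
  have den: "den \<Delta> Sig F B (Lam y M) \<alpha> = ?f \<alpha>" if "valuation \<Delta> F \<alpha>" for \<alpha>
    using f_in[OF that] by (simp add: Let_def type_of_eq[OF Lam.hyps(1)] del: fun_upd_apply)
  have app: "?f \<alpha> \<bullet> r = den \<Delta> Sig F B M (\<alpha>(y := r))" if "valuation \<Delta> F \<alpha>" "r \<in> P (\<Delta> y)" for \<alpha> r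
    using M that(2) valuation_upd[OF that(1)] by (intro vapp_vlam[where B = "F \<rho>"]) blast+
  have "lub (Arrow (\<Delta> y) \<rho>) ((\<lambda>a. den \<Delta> Sig F B (Lam y M) (\<alpha>(x := a))) ` X)
      (den \<Delta> Sig F B (Lam y M) (\<alpha>(x := s)))" if X: "admissible (\<Delta> x) X s" for x X s
  proof -
    have val: "valuation \<Delta> F (\<alpha>(x := a))" if "a \<in> P (\<Delta> x)" for a
      using Lam.prems(2) that by (rule valuation_upd)
    have s: "s \<in> P (\<Delta> x)" and XP: "\<And>a. a \<in> X \<Longrightarrow> a \<in> P (\<Delta> x)"
      using admissibleD(2,4)[OF X] by blast+
    have "lub (Arrow (\<Delta> y) \<rho>) ((\<lambda>a. ?f (\<alpha>(x := a))) ` X) (?f (\<alpha>(x := s)))"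
    proof (rule lub_Arrow_pointwiseI)
      fix r assume r: "r \<in> P (\<Delta> y)"
      have "lub \<rho> ((\<lambda>a. den \<Delta> Sig F B M (\<alpha>(x := a, y := r))) ` X) (den \<Delta> Sig F B M (\<alpha>(x := s, y := r)))"
      proof (cases "x = y")
        case True
        \<comment> \<open>The inner binding hides the outer one, so the family is constant.\<close>
        have "den \<Delta> Sig F B M (\<alpha>(y := r)) \<in> P \<rho>"
          using M valuation_upd[OF Lam.prems(2) r] by blast
        then show ?thesis
          using True lub_const[OF _ admissibleD(3)[OF X]] by (simp del: fun_upd_apply)
      next
        case False
        show ?thesis
          unfolding fun_upd_twist[OF False] using M[OF valuation_upd[OF Lam.prems(2) r]] X by blast
      qed
      moreover have "(\<lambda>g. g \<bullet> r) ` (\<lambda>a. ?f (\<alpha>(x := a))) ` X =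
          (\<lambda>a. den \<Delta> Sig F B M (\<alpha>(x := a, y := r))) ` X"
        unfolding image_image using app[OF val[OF XP] r] by (intro image_cong) auto
      ultimately show "lub \<rho> ((\<lambda>g. g \<bullet> r) ` (\<lambda>a. ?f (\<alpha>(x := a))) ` X) (?f (\<alpha>(x := s)) \<bullet> r)"
        using app[OF val[OF s] r] by (simp del: fun_upd_apply)
    qed (use f_in val s XP in blast)+
    moreover have "(\<lambda>a. den \<Delta> Sig F B (Lam y M) (\<alpha>(x := a))) ` X = (\<lambda>a. ?f (\<alpha>(x := a))) ` X"
      using den[OF val[OF XP]] by (intro image_cong) auto
    ultimately show ?thesis
      using den[OF val[OF s]] by (simp del: fun_upd_apply den.simps)
  qed
  then show ?case
    using f_in[OF Lam.prems(2)] den[OF Lam.prems(2)]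
    by (auto simp del: den.simps fun_upd_apply)
qed

lemma complete_frame:
  assumes "type_env \<Delta>"
  shows "complete_frame \<Delta> F"
  unfolding complete_frame_def frame_def
proof (intro conjI allI impI)
  show "pre_frame F"
    by (rule pre_frame)
next
  fix Sig :: "nat \<Rightarrow> ty option" and B \<alpha> x M \<rho>
  assume "signature Sig" "struct Sig F B" "valuation \<Delta> F \<alpha>"
    "has_type \<Delta> Sig (Lam x M) (Arrow (\<Delta> x) \<rho>)" "pos_existential (Lam x M)"
  then show "den \<Delta> Sig F B (Lam x M) \<alpha> = vlam (F (\<Delta> x)) (\<lambda>r. den \<Delta> Sig F B M (\<alpha>(x := r)))"
    using den_continuous[OF assms] by blast
next
  fix \<rho> R assume "relational \<rho>" "R \<subseteq> P \<rho>"
  then show "pointwise_lub F \<rho> R \<in> P \<rho>"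
    using pointwise_lub_lub unfolding is_lub_def by blast
qed

section \<open>First-order structures inside the frames\<close>

text \<open>Individuals are ordered discretely, so an admissible set of them is a singleton and
  every function preserves its supremum.\<close>

lemma standard_frame_first_order:
  "first_order \<sigma> \<or> \<sigma> = Omicron \<Longrightarrow> standard_frame D \<sigma> = F \<sigma>"
proof (induction \<sigma>)
  case (Arrow \<tau> \<sigma>)
  then have \<tau>: "\<tau> = Iota" and \<sigma>: "standard_frame D \<sigma> = F \<sigma>"
    by auto
  have "f \<in> P (Arrow \<tau> \<sigma>)" if f: "f \<in> elts (vfun (F \<tau>) (F \<sigma>))" for f
    unfolding mem_Arrow
  proof (intro conjI allI impI f)
    fix X s assume X: "admissible \<tau> X s"
    then have "X = {s}"
      using admissibleD(3)[OF X] admissibleD(5)[OF X] unfolding \<tau> by auto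
    moreover have "f \<bullet> s \<in> P \<sigma>"
      using f admissibleD(4)[OF X] by (rule vapp_in)
    ultimately show "lub \<sigma> ((\<bullet>) f ` X) (f \<bullet> s)"
      by (simp add: is_lub_def le_refl)
  qed
  then have "elts (vfun (F \<tau>) (F \<sigma>)) = P (Arrow \<tau> \<sigma>)"
    using in_vfun by blast
  then show ?case
    using \<tau> \<sigma> by (intro extensionality) simp
qed auto

lemma expands:
  assumes "fo_signature Sig" "fo_structure Sig D A"
  shows "expands Sig D A F"
  unfolding expands_def
proof (intro conjI allI impI)
  fix c \<sigma> assume "Sig c = Some \<sigma>"
  then have "first_order \<sigma>" "A c \<in> elts (standard_frame D \<sigma>)"
    using assms by (auto simp: fo_signature_def fo_structure_def struct_def)
  then show "A c \<in> P \<sigma>"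
    using standard_frame_first_order by simp
qed simp

end

section \<open>The standard, continuous and monotone frames as instances\<close>

lemma vset_elts [simp]: "vset (elts a) = a"
  using elts_vset[OF order_refl, of a] by (rule extensionality)

lemma standard_frame_eq: "standard_frame D = lub_frame (\<lambda>_. False) D"
proof
  show "standard_frame D \<sigma> = lub_frame (\<lambda>_. False) D \<sigma>" for \<sigma>
    by (induction \<sigma>) (simp_all add: lub_frame.simps(3))
qed

lemma continuous_frame_eq: "continuous_frame D = lub_frame (\<lambda>_. True) D"
proof
  show "continuous_frame D \<sigma> = lub_frame (\<lambda>_. True) D \<sigma>" for \<sigma>
    by (induction \<sigma>) (simp_all add: scott_continuous_def lub_frame.simps(3))
qed

lemma set_class_instances:
  assumes "elts D \<noteq> {}"
  shows "set_class (\<lambda>_. False) D" "set_class finite D" "set_class (\<lambda>_. True) D"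
  using assms by unfold_locales auto

text \<open>Transitivity is asked on \<open>X\<close> alone because \<open>le\<close> is known to be
  transitive only between elements of the frame.\<close>

lemma directed_finite_upper_bound:
  assumes "directed r X" "\<And>x y z. x \<in> X \<Longrightarrow> y \<in> X \<Longrightarrow> z \<in> X \<Longrightarrow> r x y \<Longrightarrow> r y z \<Longrightarrow> r x z"
  shows "finite Y \<Longrightarrow> Y \<subseteq> X \<Longrightarrow> \<exists>z \<in> X. \<forall>y \<in> Y. r y z"
proof (induction rule: finite_induct)
  case empty
  then show ?case
    using assms(1) by (auto simp: directed_def)
next
  case (insert x Y)
  then obtain z where z: "z \<in> X" "\<forall>y \<in> Y. r y z"
    by blast
  obtain w where w: "w \<in> X" "r x w" "r z w"
    using assms(1) z insert.prems unfolding directed_def by blast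
  then show ?case
    using z insert.prems assms(2) by (intro bexI[of _ w]) blast+
qed

text \<open>Two-element chains yield monotonicity. Conversely, monotone functions preserve greatest
  elements.\<close>

lemma monotone_frame_eq:
  assumes "elts D \<noteq> {}"
  shows "monotone_frame D = lub_frame finite D"
proof
  interpret set_class finite D
    by (rule set_class_instances[OF assms])
  show "monotone_frame D \<sigma> = F \<sigma>" for \<sigma>
  proof (induction \<sigma>)
    case (Arrow \<tau> \<sigma>)
    have "f \<in> P (Arrow \<tau> \<sigma>) \<longleftrightarrow> f \<in> elts (vfun (F \<tau>) (F \<sigma>)) \<and>
        (\<forall>x \<in> P \<tau>. \<forall>y \<in> P \<tau>. le \<tau> x y \<longrightarrow> le \<sigma> (f \<bullet> x) (f \<bullet> y))" for f
    proof (intro iffI conjI ballI impI)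
      fix x y assume "f \<in> P (Arrow \<tau> \<sigma>)" "x \<in> P \<tau>" "y \<in> P \<tau>" "le \<tau> x y"
      then show "le \<sigma> (f \<bullet> x) (f \<bullet> y)"
        using app_mono[of "{}"] by blast
    next
      assume f: "f \<in> elts (vfun (F \<tau>) (F \<sigma>)) \<and>
        (\<forall>x \<in> P \<tau>. \<forall>y \<in> P \<tau>. le \<tau> x y \<longrightarrow> le \<sigma> (f \<bullet> x) (f \<bullet> y))"
      show "f \<in> P (Arrow \<tau> \<sigma>)"
        unfolding mem_Arrow
      proof (intro conjI allI impI)
        fix X s assume X: "admissible \<tau> X s"
        note XP = admissibleD(2)[OF X]
        \<comment> \<open>A finite directed set contains its supremum.\<close>
        have "\<exists>z \<in> X. \<forall>y \<in> X. le \<tau> y z"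
          using X XP unfolding admissible_def
          by (intro directed_finite_upper_bound[where X = X]) (blast intro: le_trans)+
        then obtain z where z: "z \<in> X" "\<And>y. y \<in> X \<Longrightarrow> le \<tau> y z"
          by blast
        then have "s = z"
          using XP admissibleD(4,5,6)[OF X] by (intro le_antisym) auto
        then have "s \<in> X" "\<And>y. y \<in> X \<Longrightarrow> le \<sigma> (f \<bullet> y) (f \<bullet> s)"
          using z f XP by blast+
        moreover have "f \<bullet> s \<in> P \<sigma>"
          using f admissibleD(4)[OF X] by (blast intro: vapp_in)
        ultimately show "lub \<sigma> ((\<bullet>) f ` X) (f \<bullet> s)"
          unfolding is_lub_def by blast
      qed (use f in blast)
    qed (rule in_vfun)
    then have "P (Arrow \<tau> \<sigma>) = {f \<in> elts (vfun (F \<tau>) (F \<sigma>)).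
        \<forall>x \<in> P \<tau>. \<forall>y \<in> P \<tau>. le \<tau> x y \<longrightarrow> le \<sigma> (f \<bullet> x) (f \<bullet> y)}"
      by blast
    then show ?case
      unfolding monotone_frame.simps Arrow.IH by (metis vset_elts)
  qed simp_all
qed

theorem mainTheorem4:
  fixes \<Delta> :: "'x \<Rightarrow> ty"
    and Sig Sig' :: "'c \<Rightarrow> ty option"
    and D :: "'u::zermelo"
    and A :: "'c \<Rightarrow> 'u"
    and \<Gamma> :: "('x, 'c) clause set"
  assumes "type_env \<Delta>"
    and "fo_signature Sig"
    and "relational_extension Sig Sig'"
    and "fo_structure Sig D A"
    and "\<forall>C \<in> \<Gamma>. hochc \<Delta> Sig Sig' C"
  shows "(standard_satisfiable \<Delta> Sig Sig' D A \<Gamma> \<longleftrightarrow> henkin_satisfiable \<Delta> Sig Sig' D A \<Gamma>) \<and>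
    (standard_satisfiable \<Delta> Sig Sig' D A \<Gamma> \<longleftrightarrow> monotone_satisfiable \<Delta> Sig Sig' D A \<Gamma>) \<and>
    (standard_satisfiable \<Delta> Sig Sig' D A \<Gamma> \<longleftrightarrow> continuous_satisfiable \<Delta> Sig Sig' D A \<Gamma>) \<and>
    (\<forall>H. complete_frame \<Delta> H \<and> expands Sig D A H \<longrightarrow>
      (standard_satisfiable \<Delta> Sig Sig' D A \<Gamma> \<longleftrightarrow> satisfiable_in \<Delta> Sig Sig' A H \<Gamma>))"
proof -
  have D: "elts D \<noteq> {}"
    using assms(4) by (simp add: fo_structure_def)
  \<comment> \<open>A \<open>good\<close> frame can be source and target of a transfer, so all of
    them agree. A Henkin frame serves as a source, and every \<open>good\<close> frame is itself a
    Henkin frame.\<close>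
  define good where "good H \<longleftrightarrow> complete_frame \<Delta> H \<and> expands Sig D A H" for H
  have good: "good (standard_frame D)" "good (monotone_frame D)" "good (continuous_frame D)"
    unfolding good_def standard_frame_eq monotone_frame_eq[OF D] continuous_frame_eq
    using set_class_instances[OF D]
    by (auto intro: set_class.complete_frame set_class.expands assms)
  have transfer: "satisfiable_in \<Delta> Sig Sig' A H' \<Gamma>"
    if "frame \<Delta> H" "expands Sig D A H" "good H'" "satisfiable_in \<Delta> Sig Sig' A H \<Gamma>" for H H'
    using satisfiable_in_transfer[OF assms(1-3,5) that(1,2) _ _ that(4)] that(3)
    unfolding good_def by blast
  have good_frame: "frame \<Delta> H \<and> expands Sig D A H" if "good H" for H
    using that by (simp add: good_def complete_frame_def)
  have "satisfiable_in \<Delta> Sig Sig' A H \<Gamma> \<longleftrightarrow> satisfiable_in \<Delta> Sig Sig' A H' \<Gamma>"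
    if "good H" "good H'" for H H'
    using that transfer good_frame by blast
  moreover have "henkin_satisfiable \<Delta> Sig Sig' D A \<Gamma> \<longleftrightarrow> satisfiable_in \<Delta> Sig Sig' A H \<Gamma>"
    if "good H" for H
    using that transfer good_frame unfolding henkin_satisfiable_def by blast
  ultimately show ?thesis
    using good unfolding standard_satisfiable_def monotone_satisfiable_def
      continuous_satisfiable_def good_def by blast
qed

end
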